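(* Let $K\ge2$, $\alpha\in(0,\infty)^K$, and let $H:\mathbb{R}^K\to\mathbb{R}$ satisfy conditions (A1)–(A4) below at $\theta^*\in\Delta_{K-1}$; let $Z=\{i:\theta^*_i=0\}$, $m=|Z|$. Fix $\epsilon$ with $0<\epsilon<\min_{i:\theta^*_i>0}\theta^*_i$ and let $\Delta^\epsilon_{K-1}=\{\theta\in\Delta_{K-1}:\theta_i\ge\epsilon \text{ for all } i \text{ with }\theta^*_i>0\}$. If $\gamma\in(0,1)$, then as $n\to\infty$ $$\mathbb{E}_{\theta\sim\mathrm{Dir}_\alpha}\Big[e^{2nH(\theta)+n^\gamma \mathrm{KL}(\theta^*|\theta)}\mathbf{1}_{\Delta^\epsilon_{K-1}}(\theta)\Big]\sim C'_H\,e^{2nH(\theta^* )}\,n^{-\frac{K-1-m}{2}}\,n^{-\sum_{i\in Z}\alpha_i}$$ for some constant $C'_H\in(0,\infty)$.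
   Context: $\Delta_{K-1}=\{\theta\in\mathbb{R}^K:\theta_i\ge0,\sum_i\theta_i=1\}$. $\mathrm{Dir}_\alpha$ is the Dirichlet distribution on $\Delta_{K-1}$ with density $\frac{1}{B(\alpha)}\prod_{i=1}^K\theta_i^{\alpha_i-1}$ (w.r.t. Lebesgue measure in $(\theta_1,\dots,\theta_{K-1})$), $B(\alpha)=\prod_i\Gamma(\alpha_i)/\Gamma(\sum_i\alpha_i)$. $\mathrm{KL}(\theta^*|\theta)=\sum_{k=1}^K\theta^*_k\log(\theta^*_k/\theta_k)$ with conventions $0\log0=0$, $0\log\infty=0$. Conditions: (A1) $H$ attains its maximum over $\Delta_{K-1}$ only at $\theta^*$. (A2) $H$ is continuous on $\Delta_{K-1}$ and $C^2$ on an open neighborhood of $\theta^*$ in $\mathbb{R}^K$. There are unique KKT multipliers $\lambda_i\ge0$ ($i\in Z$), $\mu\in\mathbb{R}$ with $\nabla H(\theta^* )=-\sum_{i\in Z}\lambda_ie_i+\mu\mathbf{1}_K$. (A3) $\lambda_i>0$ for all $i\in Z$. (A4) $d^\top\nabla^2H(\theta^* )d<0$ for all nonzero $d\in\mathbb{R}^K$ with $\mathbf{1}_K^\top d=0$ and $d_i=0$ for $i\in Z$. Here $n$ is a positive real and $\sim$ means the ratio tends to $1$. *)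

theory Defs
  imports "HOL-Analysis.Analysis" "HOL-Library.Landau_Symbols"
begin

definition prob_simplex :: "(real^'k::finite) set" where
  "prob_simplex = {\<theta>. (\<forall>i. \<theta> $ i \<ge> 0) \<and> (\<Sum>i\<in>UNIV. \<theta> $ i) = 1}"

definition multi_beta :: "('k::finite \<Rightarrow> real) \<Rightarrow> real" where
  "multi_beta \<alpha> = (\<Prod>i\<in>UNIV. Gamma (\<alpha> i)) / Gamma (\<Sum>i\<in>UNIV. \<alpha> i)"

definition last_idx :: "'k::{finite,linorder}" where
  "last_idx = Max UNIV"

definition simplex_point :: "('k \<Rightarrow> real) \<Rightarrow> real^'k::{finite,linorder}" where
  "simplex_point x = (\<chi> i. if i = last_idx then 1 - (\<Sum>j\<in>UNIV - {last_idx}. x j) else x i)"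

definition dirichlet_expectation ::
  "('k::{finite,linorder} \<Rightarrow> real) \<Rightarrow> (real^'k::{finite,linorder} \<Rightarrow> real) \<Rightarrow> real" where
  "dirichlet_expectation \<alpha> f =
     (1 / multi_beta \<alpha>) *
     (\<integral>x. indicator prob_simplex (simplex_point x) *
           (\<Prod>i\<in>UNIV. (simplex_point x $ i) powr (\<alpha> i - 1)) * f (simplex_point x)
        \<partial>(PiM (UNIV - {last_idx}) (\<lambda>_. lborel)))"

text \<open>KL(theta* | theta) with the convention 0 log(0/t) = 0. (Only used where theta_k > 0
  whenever theta*_k > 0, so the value is finite there.)\<close>
definition KL :: "real^'k::finite \<Rightarrow> real^'k \<Rightarrow> real" where
  "KL \<theta>s \<theta> = (\<Sum>k\<in>UNIV. if \<theta>s $ k = 0 then 0 else \<theta>s $ k * ln (\<theta>s $ k / \<theta> $ k))"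

end

theory Submission
  imports Defs "HOL-Probability.Distributions" "HOL-Real_Asymp.Real_Asymp"
begin

text \<open>
  Laplace's method at a maximiser on the boundary of the simplex. Eliminate a coordinate \<open>k\<close> with
  \<open>\<theta>*\<^sub>k > 0\<close> and blow up around \<open>\<theta>*\<close> at two speeds: \<open>\<theta>\<^sub>i = u\<^sub>i / n\<close> for \<open>i \<in> Z\<close>, where \<open>H\<close> decreases
  linearly, and \<open>\<theta>\<^sub>i = \<theta>*\<^sub>i + v\<^sub>i / sqrt n\<close> for the remaining coordinates, where it decreases quadratically.
  The Jacobian and the factors \<open>\<theta>\<^sub>i powr (\<alpha>\<^sub>i - 1)\<close>, \<open>i \<in> Z\<close>, produce the powers of \<open>n\<close>, and the integrand converges
  to a product of Gamma kernels in \<open>u\<close> and a Gaussian in \<open>v\<close>. With \<open>s = (\<Sum>i\<in>Z. \<theta>\<^sub>i)\<close> and \<open>\<delta> = \<theta> - \<theta>*\<close>, the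
  KKT conditions and compactness give \<open>H \<theta> - H \<theta>* \<le> - c (s + |\<delta>|\<^sup>2)\<close> on the whole simplex, whereas
  \<open>ln x \<le> x - 1\<close> gives \<open>s \<le> KL(\<theta>*|\<theta>) \<le> s + |\<delta>|\<^sup>2 / \<epsilon>\<close> on the truncated simplex. Since \<open>\<gamma> < 1\<close>, the divergence
  term is absorbed by half of the decay of \<open>2 n H\<close>, which provides an integrable majorant, and it
  vanishes in the limit; dominated convergence concludes.
\<close>

section \<open>Integration in charts of the simplex\<close>

lemma borel_measurable_vec_nth [measurable]: "(\<lambda>\<theta>::real^'k. \<theta> $ i) \<in> borel_measurable borel"
  by (intro borel_measurable_continuous_onI continuous_intros)

text \<open>The coordinate eliminated by \<open>simplex_point\<close> may vanish at \<theta>* and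
  would then not be free to be scaled by \<open>1 / n\<close>; hence charts with an arbitrary
  eliminated coordinate.\<close>

definition simplex_chart :: "'k \<Rightarrow> ('k \<Rightarrow> real) \<Rightarrow> real^'k::finite" where
  "simplex_chart k x = (\<chi> i. if i = k then 1 - (\<Sum>j\<in>UNIV - {k}. x j) else x i)"

lemma simplex_chart_last_idx: "simplex_point = simplex_chart last_idx"
  by (simp add: fun_eq_iff simplex_point_def simplex_chart_def)

lemma simplex_chart_cong:
  "(\<And>i. i \<noteq> k \<Longrightarrow> x i = y i) \<Longrightarrow> simplex_chart k x = simplex_chart k y"
  by (auto simp: simplex_chart_def vec_eq_iff intro!: sum.cong)

lemma measurable_simplex_chart [measurable]:
  fixes k :: "'k::finite"
  shows "simplex_chart k \<in> borel_measurable (PiM (UNIV - {k}) (\<lambda>_. lborel))"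
proof (subst borel_measurable_euclidean_space, intro ballI)
  fix b :: "real^'k" assume "b \<in> Basis"
  then obtain i where b: "b = axis i 1"
    by (auto simp: Basis_vec_def)
  show "(\<lambda>x. simplex_chart k x \<bullet> b) \<in> borel_measurable (PiM (UNIV - {k}) (\<lambda>_. lborel))"
    by (cases "i = k") (auto simp: b inner_axis simplex_chart_def)
qed

lemma product_sigma_finite_lborel: "product_sigma_finite (\<lambda>_. lborel :: real measure)"
  by (intro product_sigma_finite.intro sigma_finite_lborel)

text \<open>The one-dimensional case of both changes of variables below: \<open>c = r i\<close> for
  the rescaling, \<open>c = - 1\<close> for the reflection between charts.\<close>

lemma emeasure_lborel_affine_vimage:
  fixes t c :: real
  assumes "c \<noteq> 0" and A: "A \<in> sets borel"
  shows "ennreal \<bar>c\<bar> * emeasure lborel ((\<lambda>x. t + c * x) -` A) = emeasure lborel A"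
proof -
  have "emeasure lborel A = emeasure (density (distr lborel borel (\<lambda>x. t + c * x)) (\<lambda>_. ennreal \<bar>c\<bar>)) A"
    using lborel_real_affine[OF assms(1), of t] by simp
  also have "\<dots> = ennreal \<bar>c\<bar> * emeasure lborel ((\<lambda>x. t + c * x) -` A)"
    using A by (simp add: emeasure_density nn_integral_cmult_indicator emeasure_distr)
  finally show ?thesis ..
qed

text \<open>The product measure is determined by its values on boxes, and the preimage of a box
  under a coordinatewise affine map is again a box, so dimension one suffices.\<close>

lemma integral_PiM_lborel_affine:
  fixes f :: "('i \<Rightarrow> real) \<Rightarrow> real" and r c :: "'i \<Rightarrow> real"
  assumes I: "finite I" and r: "\<And>i. i \<in> I \<Longrightarrow> 0 < r i"
    and f: "f \<in> borel_measurable (PiM I (\<lambda>_. lborel))"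
  shows "(\<integral>x. f x \<partial>PiM I (\<lambda>_. lborel)) =
    (\<Prod>i\<in>I. r i) * (\<integral>y. f (\<lambda>i\<in>I. c i + r i * y i) \<partial>PiM I (\<lambda>_. lborel))"
proof -
  interpret product_sigma_finite "\<lambda>_::'i. lborel :: real measure"
    by (rule product_sigma_finite_lborel)
  let ?M = "PiM I (\<lambda>_. lborel :: real measure)"
  let ?T = "\<lambda>y. \<lambda>i\<in>I. c i + r i * y i"
  have T: "?T \<in> measurable ?M ?M"
    by measurable
  have R: "0 \<le> (\<Prod>i\<in>I. r i)"
    using r by (intro prod_nonneg) (auto intro: less_imp_le)
  have eq: "density (distr ?M ?M ?T) (\<lambda>_. ennreal (\<Prod>i\<in>I. r i)) = ?M"
  proof (rule PiM_eqI)
    fix A :: "'i \<Rightarrow> real set" assume A: "\<And>i. i \<in> I \<Longrightarrow> A i \<in> sets lborel"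
    have PA: "Pi\<^sub>E I A \<in> sets ?M"
      using A I by (intro sets_PiM_I_finite) auto
    have vi: "?T -` Pi\<^sub>E I A \<inter> space ?M = Pi\<^sub>E I (\<lambda>i. (\<lambda>x. c i + r i * x) -` A i)"
      by (auto simp: space_PiM PiE_iff)
    have "emeasure (density (distr ?M ?M ?T) (\<lambda>_. ennreal (\<Prod>i\<in>I. r i))) (Pi\<^sub>E I A)
      = ennreal (\<Prod>i\<in>I. r i) * emeasure ?M (Pi\<^sub>E I (\<lambda>i. (\<lambda>x. c i + r i * x) -` A i))"
      using PA T by (simp add: emeasure_density nn_integral_cmult_indicator emeasure_distr vi)
    also have "emeasure ?M (Pi\<^sub>E I (\<lambda>i. (\<lambda>x. c i + r i * x) -` A i))
      = (\<Prod>i\<in>I. emeasure lborel ((\<lambda>x. c i + r i * x) -` A i))"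
    proof (rule emeasure_PiM[OF I])
      fix i assume "i \<in> I"
      have "(\<lambda>x. c i + r i * x) -` A i \<inter> space lborel \<in> sets lborel"
        using A[OF \<open>i \<in> I\<close>] by (intro measurable_sets[where A=lborel and M=lborel]) auto
      then show "(\<lambda>x. c i + r i * x) -` A i \<in> sets lborel" by simp
    qed
    also have "ennreal (\<Prod>i\<in>I. r i) * \<dots> =
      (\<Prod>i\<in>I. ennreal (r i) * emeasure lborel ((\<lambda>x. c i + r i * x) -` A i))"
      using r by (simp add: prod_ennreal less_imp_le prod.distrib flip: prod_ennreal)
    also have "\<dots> = (\<Prod>i\<in>I. emeasure lborel (A i))"
    proof (rule prod.cong[OF refl])
      fix i assume i: "i \<in> I"
      show "ennreal (r i) * emeasure lborel ((\<lambda>x. c i + r i * x) -` A i) = emeasure lborel (A i)"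
        using emeasure_lborel_affine_vimage[of "r i" "A i" "c i"] r[OF i] A[OF i] by simp
    qed
    finally show "emeasure (density (distr ?M ?M ?T) (\<lambda>_. ennreal (\<Prod>i\<in>I. r i))) (Pi\<^sub>E I A)
      = (\<Prod>i\<in>I. emeasure lborel (A i))" .
  qed (use I in auto)
  have "(\<integral>x. f x \<partial>?M) = (\<integral>x. f x \<partial>density (distr ?M ?M ?T) (\<lambda>_. ennreal (\<Prod>i\<in>I. r i)))"
    by (simp only: eq)
  also have "\<dots> = (\<Prod>i\<in>I. r i) * (\<integral>y. f (?T y) \<partial>?M)"
    using R f T by (subst integral_density) (simp_all add: integral_distr)
  finally show ?thesis .
qed

text \<open>Two charts differ by a shear, which in one coordinate is the reflection \<open>y \<mapsto> t - y\<close>.\<close>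
lemma integral_simplex_chart_eq:
  fixes f :: "real^'k::finite \<Rightarrow> real"
  assumes f: "f \<in> borel_measurable borel"
  shows "(\<integral>x. f (simplex_chart k x) \<partial>PiM (UNIV - {k}) (\<lambda>_. lborel)) =
    (\<integral>x. f (simplex_chart l x) \<partial>PiM (UNIV - {l}) (\<lambda>_. lborel))"
proof (cases "k = l")
  case False
  interpret product_sigma_finite "\<lambda>_::'k. lborel :: real measure"
    by (rule product_sigma_finite_lborel)
  define J where "J = UNIV - {k, l}"
  have J: "finite J" "k \<notin> J" "l \<notin> J" "UNIV - {k} = insert l J" "UNIV - {l} = insert k J"
    using False by (auto simp: J_def)
  \<comment> \<open>The index names the coordinate that is kept: \<open>?M k\<close> carries the
    chart eliminating \<open>l\<close>, and \<open>?M l\<close> the chart eliminating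
    \<open>k\<close>. The map \<open>T\<close> below passes from the former to the latter.\<close>
  let ?M = "\<lambda>i. PiM (insert i J) (\<lambda>_. lborel :: real measure)"
  define T where "T x = (\<lambda>i\<in>insert l J. if i = l then 1 - (\<Sum>j\<in>insert k J. x j) else x i)" for x :: "'k \<Rightarrow> real"
  have T [measurable]: "T \<in> measurable (?M k) (?M l)"
    unfolding T_def by (rule measurable_restrict) auto
  have chart: "simplex_chart k (T x) = simplex_chart l x" for x
  proof -
    have "(\<Sum>j\<in>UNIV - {k}. T x j) = 1 - (\<Sum>j\<in>insert k J. x j) + (\<Sum>j\<in>J. x j)"
      unfolding J(4) using J(1-3) by (simp add: T_def cong: sum.cong)
        (intro sum.cong, auto)
    also have "\<dots> = 1 - x k"
      using J by simp
    finally show ?thesis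
      unfolding simplex_chart_def J(5) using J False
      by (auto simp: vec_eq_iff T_def J_def)
  qed
  have "distr (?M k) (?M l) T = ?M l"
  proof (rule PiM_eqI)
    fix A :: "'k \<Rightarrow> real set" assume A: "\<And>i. i \<in> insert l J \<Longrightarrow> A i \<in> sets lborel"
    have PA: "Pi\<^sub>E (insert l J) A \<in> sets (?M l)"
      using A J(1) by (intro sets_PiM_I_finite) auto
    have "emeasure (distr (?M k) (?M l) T) (Pi\<^sub>E (insert l J) A) =
      (\<integral>\<^sup>+x. indicator (Pi\<^sub>E (insert l J) A) x \<partial>distr (?M k) (?M l) T)"
      using PA by (intro nn_integral_indicator[symmetric]) simp
    also have "\<dots> = (\<integral>\<^sup>+x. indicator (Pi\<^sub>E (insert l J) A) (T x) \<partial>?M k)"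
      using PA by (intro nn_integral_distr) auto
    \<comment> \<open>With the coordinates in \<open>J\<close> fixed, only coordinate
      \<open>l\<close> of \<open>T\<close> depends on \<open>y\<close>, so the inner integral is the
      measure of a reflected copy of \<open>A l\<close>.\<close>
    also have "\<dots> = (\<integral>\<^sup>+x. \<integral>\<^sup>+y. indicator (Pi\<^sub>E (insert l J) A) (T (x(k := y))) \<partial>lborel \<partial>PiM J (\<lambda>_. lborel))"
      using J PA by (intro product_nn_integral_insert) auto
    also have "\<dots> = (\<integral>\<^sup>+x. (\<Prod>i\<in>J. indicator (A i) (x i)) * emeasure lborel (A l) \<partial>PiM J (\<lambda>_. lborel))"
    proof (rule nn_integral_cong)
      fix x assume x: "x \<in> space (PiM J (\<lambda>_. lborel :: real measure))"
      define t where "t = 1 - (\<Sum>j\<in>J. x j)"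
      have Tk: "T (x(k := y)) \<in> Pi\<^sub>E (insert l J) A \<longleftrightarrow> (\<forall>i\<in>J. x i \<in> A i) \<and> t - y \<in> A l" for y
      proof -
        have "(\<Sum>j\<in>insert k J. (x(k := y)) j) = y + (\<Sum>j\<in>J. x j)"
          using J by simp (intro sum.cong, auto)
        then have "T (x(k := y)) = (\<lambda>i\<in>insert l J. if i = l then t - y else x i)"
          using J by (auto simp: T_def t_def fun_eq_iff)
        then show ?thesis
          using J by (auto simp: PiE_iff)
      qed
      have "(\<integral>\<^sup>+y. indicator (Pi\<^sub>E (insert l J) A) (T (x(k := y))) \<partial>lborel)
        = (\<integral>\<^sup>+y. (\<Prod>i\<in>J. indicator (A i) (x i)) * indicator ((\<lambda>y. t + (-1) * y) -` A l) y \<partial>lborel)"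
        using J(1) by (intro nn_integral_cong) (auto simp: indicator_def Tk intro!: prod.neutral)
      also have "\<dots> = (\<Prod>i\<in>J. indicator (A i) (x i)) * emeasure lborel ((\<lambda>y. t + (-1) * y) -` A l)"
      proof (rule nn_integral_cmult_indicator)
        have "(\<lambda>y. t + (-1) * y) -` A l \<inter> space lborel \<in> sets lborel"
          using A[of l] by (intro measurable_sets[where A=lborel and M=lborel]) auto
        then show "(\<lambda>y. t + (-1) * y) -` A l \<in> sets lborel" by simp
      qed
      also have "emeasure lborel ((\<lambda>y. t + (-1) * y) -` A l) = emeasure lborel (A l)"
        using emeasure_lborel_affine_vimage[of "-1" "A l" t] A[of l] by simp
      finally show "(\<integral>\<^sup>+y. indicator (Pi\<^sub>E (insert l J) A) (T (x(k := y))) \<partial>lborel)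
        = (\<Prod>i\<in>J. indicator (A i) (x i)) * emeasure lborel (A l)" .
    qed
    also have "\<dots> = (\<integral>\<^sup>+x. (\<Prod>i\<in>J. indicator (A i) (x i)) \<partial>PiM J (\<lambda>_. lborel)) * emeasure lborel (A l)"
    proof (rule nn_integral_multc)
      have "(\<lambda>x. indicator (A i) (x i) :: ennreal) \<in> borel_measurable (PiM J (\<lambda>_. lborel))" if "i \<in> J" for i
        using A that by (intro measurable_compose[OF measurable_component_singleton]) auto
      then show "(\<lambda>x. \<Prod>i\<in>J. indicator (A i) (x i) :: ennreal) \<in> borel_measurable (PiM J (\<lambda>_. lborel))"
        by measurable
    qed
    also have "\<dots> = (\<Prod>i\<in>insert l J. emeasure lborel (A i))"
      using A J by (subst product_nn_integral_prod) (auto simp: mult.commute)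
    finally show "emeasure (distr (?M k) (?M l) T) (Pi\<^sub>E (insert l J) A) = (\<Prod>i\<in>insert l J. emeasure lborel (A i))" .
  qed (use J in auto)
  then have "(\<integral>x. f (simplex_chart k x) \<partial>?M l) = (\<integral>x. f (simplex_chart k x) \<partial>distr (?M k) (?M l) T)"
    by simp
  also have "\<dots> = (\<integral>x. f (simplex_chart k (T x)) \<partial>?M k)"
    using f measurable_simplex_chart[of k] J(4) by (intro integral_distr) auto
  finally show ?thesis
    by (simp add: chart J)
qed simp

section \<open>Integrability of the one-dimensional kernels\<close>

text \<open>The norm of the integrand of Euler's integral for the complex Gamma function, which
  converges absolutely, is this kernel.\<close>

lemma integrable_gamma_kernel:
  fixes a c :: real
  assumes "0 < a" "0 < c"
  shows "integrable lborel (\<lambda>u. indicator {0<..} u * (u powr (a - 1) * exp (- c * u)))"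
proof -
  have "(\<lambda>t. complex_of_real t powr (of_real a - 1) / of_real (exp (c * t))) absolutely_integrable_on {0<..}"
    using assms by (intro absolutely_integrable_Gamma_integral) auto
  then have "set_integrable lebesgue {0<..} (\<lambda>t. norm (complex_of_real t powr (of_real a - 1) / of_real (exp (c * t))))"
    by (rule set_integrable_norm)
  also have "?this \<longleftrightarrow> set_integrable lebesgue {0<..} (\<lambda>u. u powr (a - 1) * exp (- c * u))"
    by (intro set_integrable_cong refl)
      (auto simp: norm_divide norm_powr_real_powr exp_minus field_simps)
  finally show ?thesis
    by (simp add: set_integrable_def integrable_completion mult.assoc)
qed

lemma integrable_gaussian_kernel:
  fixes c :: real
  assumes "0 < c"
  shows "integrable lborel (\<lambda>v. exp (- c * v\<^sup>2))"
proof -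
  \<comment> \<open>The standard deviation for which the normal density is a multiple of
    \<open>exp (- c * v\<^sup>2)\<close>.\<close>
  define s where "s = sqrt (1 / (2 * c))"
  have s: "s > 0" "s\<^sup>2 = 1 / (2 * c)"
    using assms by (auto simp: s_def)
  have "integrable lborel (\<lambda>v. sqrt (2 * pi * s\<^sup>2) * normal_density 0 s v)"
    using s by (intro integrable_mult_right integrable_normal_density)
  moreover have "sqrt (2 * pi * s\<^sup>2) * normal_density 0 s v = exp (- c * v\<^sup>2)" for v
    using s assms by (simp add: normal_density_def field_simps)
  ultimately show ?thesis by simp
qed

section \<open>Taylor expansion and Kullback-Leibler bounds\<close>

text \<open>The mean value theorem along segments from \<open>x\<close> avoids any appeal to symmetry of the Hessian.\<close>
lemma second_order_Taylor:
  fixes H :: "'a::euclidean_space \<Rightarrow> real" and grad :: "'a \<Rightarrow> 'a" and D :: "'a \<Rightarrow> 'a"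
  assumes U: "open U" "x \<in> U"
    and H: "\<And>y. y \<in> U \<Longrightarrow> (H has_derivative (\<lambda>h. grad y \<bullet> h)) (at y)"
    and D: "(grad has_derivative D) (at x)"
  shows "((\<lambda>h. (H (x + h) - H x - grad x \<bullet> h - (h \<bullet> D h) / 2) / (norm h)\<^sup>2) \<longlongrightarrow> 0) (nhds 0)"
proof (rule tendstoI)
  fix e :: real assume "0 < e"
  interpret D: bounded_linear D using D by (rule has_derivative_bounded_linear)
  obtain r1 where r1: "r1 > 0" "ball x r1 \<subseteq> U"
    using U by (auto simp: open_contains_ball)
  obtain r2 where r2: "r2 > 0"
    "\<And>y. norm (y - x) < r2 \<Longrightarrow> norm (grad y - grad x - D (y - x)) \<le> e / 2 * norm (y - x)"
    using D \<open>0 < e\<close> unfolding has_derivative_at_alt by (meson half_gt_zero)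
  have "dist ((H (x + h) - H x - grad x \<bullet> h - (h \<bullet> D h) / 2) / (norm h)\<^sup>2) 0 < e"
    if h: "norm h < min r1 r2" for h
  proof (cases "h = 0")
    \<comment> \<open>At \<open>h = 0\<close> the quotient is \<open>0 / 0 = 0\<close>, so the limit
      holds along \<open>nhds 0\<close> and can be composed with increments that may vanish.\<close>
    case True then show ?thesis using \<open>0 < e\<close> by simp
  next
    case False
    \<comment> \<open>Subtracting the quadratic model along the segment leaves as derivative the
      remainder in the differentiability of \<open>grad\<close> at \<open>x\<close>, paired with
      \<open>h\<close>; it is at most \<open>e / 2\<close> times the square of the norm of
      \<open>h\<close>.\<close>
    define \<phi> where "\<phi> t = H (x + t *\<^sub>R h) - t * (grad x \<bullet> h) - t\<^sup>2 * (h \<bullet> D h) / 2" for t :: real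
    define \<phi>' where "\<phi>' t = (grad (x + t *\<^sub>R h) - grad x - t *\<^sub>R D h) \<bullet> h" for t
    have der: "(\<phi> has_derivative (\<lambda>s. s * \<phi>' t)) (at t within {0..1})" if t: "0 \<le> t" "t \<le> 1" for t
    proof -
      have "norm (t *\<^sub>R h) < r1"
        using t h by (simp add: mult_left_le_one_le order_le_less_trans[of _ "norm h"])
      then have "x + t *\<^sub>R h \<in> U"
        using r1 by (auto simp: dist_norm subset_iff)
      then have "(H has_derivative (\<lambda>k. grad (x + t *\<^sub>R h) \<bullet> k)) (at (x + t *\<^sub>R h))"
        by (rule H)
      then have 1: "((\<lambda>t. H (x + t *\<^sub>R h)) has_derivative (\<lambda>s. grad (x + t *\<^sub>R h) \<bullet> (s *\<^sub>R h))) (at t within {0..1})"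
        by (rule has_derivative_compose[rotated]) (auto intro!: derivative_eq_intros)
      show ?thesis
        unfolding \<phi>_def \<phi>'_def
        by (rule derivative_eq_intros refl 1)+
          (auto simp: fun_eq_iff algebra_simps inner_simps inner_commute)
    qed
    obtain t where t: "0 < t" "t < 1" "\<phi> 1 - \<phi> 0 = \<phi>' t"
      using mvt_simple[of 0 1 \<phi> "\<lambda>t s. s * \<phi>' t"] der by auto
    have th: "norm (t *\<^sub>R h) \<le> norm h" "norm (t *\<^sub>R h) < r2"
      using t h by (simp_all add: mult_left_le_one_le order_le_less_trans[of _ "norm h"])
    have "\<bar>\<phi>' t\<bar> \<le> norm (grad (x + t *\<^sub>R h) - grad x - t *\<^sub>R D h) * norm h"
      unfolding \<phi>'_def by (rule Cauchy_Schwarz_ineq2)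
    also have "\<dots> \<le> (e / 2 * norm (t *\<^sub>R h)) * norm h"
      using r2(2)[of "x + t *\<^sub>R h"] th by (intro mult_right_mono) (simp_all add: D.scaleR)
    also have "\<dots> \<le> (e / 2 * norm h) * norm h"
      using th(1) \<open>0 < e\<close> by (intro mult_right_mono mult_left_mono) auto
    finally have "\<bar>\<phi>' t\<bar> \<le> e / 2 * (norm h)\<^sup>2"
      by (simp add: power2_eq_square)
    moreover have "\<phi> 1 - \<phi> 0 = H (x + h) - H x - grad x \<bullet> h - (h \<bullet> D h) / 2"
      by (simp add: \<phi>_def)
    ultimately have "\<bar>H (x + h) - H x - grad x \<bullet> h - (h \<bullet> D h) / 2\<bar> \<le> e / 2 * (norm h)\<^sup>2"
      using t by simp
    also have "\<dots> < e * (norm h)\<^sup>2"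
      using False \<open>0 < e\<close> by simp
    finally show ?thesis
      using False by (simp add: dist_real_def abs_divide pos_divide_less_eq)
  qed
  then show "\<forall>\<^sub>F h in nhds 0. dist ((H (x + h) - H x - grad x \<bullet> h - (h \<bullet> D h) / 2) / (norm h)\<^sup>2) 0 < e"
    unfolding eventually_nhds_metric using r1 r2 by (intro exI[of _ "min r1 r2"]) auto
qed

text \<open>The increment is \<open>z n / sqrt n\<close> with \<open>z n = a + b / sqrt n\<close>.
  Since \<open>grad x\<close> annihilates \<open>a\<close>, the gradient contributes exactly
  \<open>grad x \<bullet> b\<close> after multiplication by \<open>n\<close>; the quadratic form in
  \<open>z n\<close> converges by continuity, and the Taylor remainder is of order o(1/n).\<close>

lemma scaled_increment_tendsto:
  fixes H :: "'a::euclidean_space \<Rightarrow> real" and grad :: "'a \<Rightarrow> 'a" and D :: "'a \<Rightarrow> 'a"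
  assumes U: "open U" "x \<in> U"
    and H: "\<And>y. y \<in> U \<Longrightarrow> (H has_derivative (\<lambda>h. grad y \<bullet> h)) (at y)"
    and D: "(grad has_derivative D) (at x)"
    and a: "grad x \<bullet> a = 0"
  shows "((\<lambda>n. n * (H (x + ((1 / sqrt n) *\<^sub>R a + (1 / n) *\<^sub>R b)) - H x)) \<longlongrightarrow>
    grad x \<bullet> b + (a \<bullet> D a) / 2) at_top"
proof -
  interpret D: bounded_linear D using D by (rule has_derivative_bounded_linear)
  define R where "R h = (H (x + h) - H x - grad x \<bullet> h - (h \<bullet> D h) / 2) / (norm h)\<^sup>2" for h
  define z where "z n = a + (1 / sqrt n) *\<^sub>R b" for n :: real
  have s0: "((\<lambda>n::real. 1 / sqrt n) \<longlongrightarrow> 0) at_top"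
    by real_asymp
  have z: "(z \<longlongrightarrow> a) at_top"
    unfolding z_def by (rule tendsto_eq_intros s0 refl)+ simp
  have h: "((\<lambda>n. (1 / sqrt n) *\<^sub>R z n) \<longlongrightarrow> 0) at_top"
    by (rule tendsto_eq_intros s0 z)+ simp
  have R: "((\<lambda>n. R ((1 / sqrt n) *\<^sub>R z n)) \<longlongrightarrow> 0) at_top"
    using second_order_Taylor[OF U H D] h unfolding R_def[symmetric] by (rule filterlim_compose)
  have "((\<lambda>n. grad x \<bullet> b + (z n \<bullet> D (z n)) / 2 + R ((1 / sqrt n) *\<^sub>R z n) * (norm (z n))\<^sup>2)
    \<longlongrightarrow> grad x \<bullet> b + (a \<bullet> D a) / 2 + 0 * (norm a)\<^sup>2) at_top"
    by (intro tendsto_intros z R D.tendsto) auto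
  moreover have "\<forall>\<^sub>F n in at_top. grad x \<bullet> b + (z n \<bullet> D (z n)) / 2 + R ((1 / sqrt n) *\<^sub>R z n) * (norm (z n))\<^sup>2
    = n * (H (x + ((1 / sqrt n) *\<^sub>R a + (1 / n) *\<^sub>R b)) - H x)"
    using eventually_gt_at_top[of 0]
  proof eventually_elim
    case (elim n)
    define h where "h = (1 / sqrt n) *\<^sub>R z n"
    have n: "sqrt n * sqrt n = n" "sqrt n > 0"
      using elim by auto
    have h_eq: "h = (1 / sqrt n) *\<^sub>R a + (1 / n) *\<^sub>R b"
      using n by (simp add: h_def z_def scaleR_add_right)
    have zh: "z n = sqrt n *\<^sub>R h"
      using n by (simp add: h_def)
    have 1: "z n \<bullet> D (z n) = n * (h \<bullet> D h)"
      using n by (simp add: zh D.scaleR)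
    have 2: "grad x \<bullet> b = n * (grad x \<bullet> h)"
      using elim a by (simp add: h_eq inner_simps)
    have 3: "(norm (z n))\<^sup>2 = n * (norm h)\<^sup>2"
      using elim by (simp add: zh power_mult_distrib)
    have 4: "R h * (norm h)\<^sup>2 = H (x + h) - H x - grad x \<bullet> h - (h \<bullet> D h) / 2"
      by (cases "h = 0") (simp_all add: R_def)
    have "grad x \<bullet> b + (z n \<bullet> D (z n)) / 2 + R h * (norm (z n))\<^sup>2
      = n * (grad x \<bullet> h + (h \<bullet> D h) / 2 + R h * (norm h)\<^sup>2)"
      unfolding 1 2 3 by (simp add: algebra_simps)
    also have "\<dots> = n * (H (x + h) - H x)"
      unfolding 4 by simp
    finally show ?case by (simp add: h_def[symmetric] h_eq[symmetric])
  qed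
  ultimately show ?thesis
    by (simp add: Lim_transform_eventually)
qed

section \<open>Penalties on compact sets and compactness of the simplex\<close>

text \<open>Where \<open>f\<close> is nonnegative, \<open>g\<close> has a positive lower bound
  \<open>G\<close>, so a large multiple of \<open>g\<close> exceeds the upper bound \<open>F\<close>
  of \<open>f\<close>; elsewhere \<open>f\<close> is already negative. The maximum of
  \<open>f - M * g\<close> over \<open>S\<close> is therefore negative and supplies
  \<open>c\<close>.\<close>

lemma compact_penalty:
  fixes f g :: "'a::topological_space \<Rightarrow> real"
  assumes S: "compact S" and f: "continuous_on S f" and g: "continuous_on S g"
    and g0: "\<And>x. x \<in> S \<Longrightarrow> 0 \<le> g x" and neg: "\<And>x. x \<in> S \<Longrightarrow> g x = 0 \<Longrightarrow> f x < 0"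
  obtains c M where "0 < c" "0 < M" "\<And>x. x \<in> S \<Longrightarrow> f x \<le> - c + M * g x"
proof -
  obtain F where F: "F > 0" "\<And>x. x \<in> S \<Longrightarrow> f x \<le> F"
    using compact_imp_bounded[OF compact_continuous_image[OF f S]]
    unfolding bounded_pos by (fastforce simp: abs_le_iff)
  define T where "T = {x\<in>S. f x \<ge> 0}"
  have "closedin (top_of_set S) (S \<inter> f -` {0..})"
    using f by (intro continuous_closedin_preimage) auto
  then have T: "compact T"
    using closedin_compact[OF S] by (simp add: T_def vimage_def Int_def)
  obtain G where G: "G > 0" "\<And>x. x \<in> T \<Longrightarrow> g x \<ge> G"
  proof (cases "T = {}")
    case False
    then obtain x0 where x0: "x0 \<in> T" "\<And>x. x \<in> T \<Longrightarrow> g x0 \<le> g x"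
      using continuous_attains_inf[OF T False continuous_on_subset[OF g]] by (auto simp: T_def)
    have "g x0 > 0"
      using x0(1) g0[of x0] neg[of x0] by (force simp: T_def order_le_less)
    then show ?thesis using x0 that by blast
  qed (auto intro: that[of 1])
  define M where "M = (F + 1) / G"
  have M: "M > 0" using F G by (simp add: M_def)
  have h: "f x - M * g x < 0" if x: "x \<in> S" for x
  proof (cases "x \<in> T")
    case True
    have "F + 1 = M * G" using G by (simp add: M_def)
    also have "\<dots> \<le> M * g x" using G(2)[OF True] M by simp
    finally show ?thesis using F(2)[OF x] by simp
  next
    case False
    then have "f x < 0" using x by (auto simp: T_def)
    moreover have "0 \<le> M * g x" using M g0[OF x] by simp
    ultimately show ?thesis by simp
  qed
  show ?thesis
  proof (cases "S = {}")
    case False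
    have "continuous_on S (\<lambda>x. f x - M * g x)"
      using f g by (intro continuous_intros)
    from continuous_attains_sup[OF S False this]
    obtain x0 where "x0 \<in> S" "\<And>x. x \<in> S \<Longrightarrow> f x - M * g x \<le> f x0 - M * g x0"
      by blast
    then show ?thesis
      using h M by (intro that[of "- (f x0 - M * g x0)" M]) (auto simp: algebra_simps)
  qed (use that[of 1 1] in auto)
qed

lemma compact_prob_simplex: "compact (prob_simplex :: (real^'k::finite) set)"
proof (rule compact_eq_bounded_closed[THEN iffD2], rule conjI)
  have "norm \<theta> \<le> 1" if "\<theta> \<in> prob_simplex" for \<theta> :: "real^'k"
    using that norm_le_l1_cart[of \<theta>] by (simp add: prob_simplex_def)
  then show "bounded (prob_simplex :: (real^'k) set)"
    by (auto simp: bounded_iff)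
  show "closed (prob_simplex :: (real^'k) set)"
    unfolding prob_simplex_def
    by (intro closed_Collect_conj closed_Collect_all closed_Collect_le closed_Collect_eq continuous_intros)
qed

section \<open>Bounds on the divergence\<close>

text \<open>Both points have total mass one. This turns the first-order part of the divergence, a
  sum over the support of \<theta>*, into mass on the zero set.\<close>

lemma prob_simplex_sum_zero_set:
  assumes "\<theta>s \<in> prob_simplex" "\<theta> \<in> prob_simplex"
  shows "(\<Sum>i | \<theta>s $ i \<noteq> 0. \<theta>s $ i - \<theta> $ i) = (\<Sum>i | \<theta>s $ i = 0. \<theta> $ i)"
proof -
  have "(\<Sum>i\<in>UNIV. \<theta>s $ i - \<theta> $ i) = 0"
    using assms by (simp add: prob_simplex_def sum_subtractf)
  moreover have "(\<Sum>i\<in>UNIV. \<theta>s $ i - \<theta> $ i) =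
    (\<Sum>i | \<theta>s $ i \<noteq> 0. \<theta>s $ i - \<theta> $ i) + (\<Sum>i | \<theta>s $ i = 0. \<theta>s $ i - \<theta> $ i)"
    by (subst sum.union_disjoint[symmetric]) (auto intro: sum.cong)
  ultimately show ?thesis
    by (simp add: sum_negf)
qed

lemma KL_eq: "KL \<theta>s \<theta> = (\<Sum>i | \<theta>s $ i \<noteq> 0. \<theta>s $ i * ln (\<theta>s $ i / \<theta> $ i))"
  unfolding KL_def by (rule sum.mono_neutral_cong_right) auto

text \<open>For \<open>x = \<theta> $ i / \<theta>s $ i\<close> the inequality ln x \<le> x - 1
  bounds each summand below by \<open>\<theta>s $ i - \<theta> $ i\<close>. Nonnegativity of the
  divergence follows from it.\<close>

lemma KL_ge_zero_set_mass:
  assumes "\<theta>s \<in> prob_simplex" "\<theta> \<in> prob_simplex" "\<And>i. \<theta>s $ i > 0 \<Longrightarrow> \<theta> $ i > 0"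
  shows "(\<Sum>i | \<theta>s $ i = 0. \<theta> $ i) \<le> KL \<theta>s \<theta>"
  unfolding KL_eq prob_simplex_sum_zero_set[OF assms(1,2), symmetric]
proof (rule sum_mono)
  fix i assume "i \<in> {i. \<theta>s $ i \<noteq> 0}"
  then have i: "\<theta>s $ i > 0" "\<theta> $ i > 0"
    using assms by (auto simp: prob_simplex_def order_le_less)
  have "ln (\<theta> $ i / \<theta>s $ i) \<le> \<theta> $ i / \<theta>s $ i - 1"
    using i by (intro ln_le_minus_one) simp
  then have "\<theta>s $ i * (1 - \<theta> $ i / \<theta>s $ i) \<le> \<theta>s $ i * ln (\<theta>s $ i / \<theta> $ i)"
    using i by (intro mult_left_mono) (auto simp: ln_div)
  then show "\<theta>s $ i - \<theta> $ i \<le> \<theta>s $ i * ln (\<theta>s $ i / \<theta> $ i)"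
    using i by (simp add: right_diff_distrib)
qed

text \<open>Now ln x \<le> x - 1 is applied to the inverse ratio. Beyond the linear term it leaves
  \<open>(\<theta> $ i - \<theta>s $ i)\<^sup>2 / \<theta> $ i\<close>, whose denominator is at
  least \<epsilon>.\<close>

lemma KL_le_zero_set_mass:
  assumes "\<theta>s \<in> prob_simplex" "\<theta> \<in> prob_simplex" "0 < \<epsilon>" "\<And>i. \<theta>s $ i > 0 \<Longrightarrow> \<epsilon> \<le> \<theta> $ i"
  shows "KL \<theta>s \<theta> \<le> (\<Sum>i | \<theta>s $ i = 0. \<theta> $ i) + (norm (\<theta> - \<theta>s))\<^sup>2 / \<epsilon>"
proof -
  have "KL \<theta>s \<theta> \<le> (\<Sum>i | \<theta>s $ i \<noteq> 0. (\<theta>s $ i - \<theta> $ i) + (\<theta> $ i - \<theta>s $ i)\<^sup>2 / \<epsilon>)"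
    unfolding KL_eq
  proof (rule sum_mono)
    fix i assume "i \<in> {i. \<theta>s $ i \<noteq> 0}"
    then have i: "\<theta>s $ i > 0" "\<epsilon> \<le> \<theta> $ i"
      using assms(1) assms(4)[of i] by (auto simp: prob_simplex_def order_le_less)
    then have "\<theta> $ i > 0"
      using assms(3) by simp
    note i = i this
    have "\<theta>s $ i * ln (\<theta>s $ i / \<theta> $ i) \<le> \<theta>s $ i * (\<theta>s $ i / \<theta> $ i - 1)"
      using i by (intro mult_left_mono ln_le_minus_one) auto
    also have "\<dots> = (\<theta>s $ i - \<theta> $ i) + (\<theta> $ i - \<theta>s $ i)\<^sup>2 / \<theta> $ i"
      using i by (simp add: field_simps power2_eq_square)
    also have "\<dots> \<le> (\<theta>s $ i - \<theta> $ i) + (\<theta> $ i - \<theta>s $ i)\<^sup>2 / \<epsilon>"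
      using i assms(3) by (intro add_left_mono divide_left_mono) auto
    finally show "\<theta>s $ i * ln (\<theta>s $ i / \<theta> $ i) \<le> (\<theta>s $ i - \<theta> $ i) + (\<theta> $ i - \<theta>s $ i)\<^sup>2 / \<epsilon>" .
  qed
  also have "\<dots> = (\<Sum>i | \<theta>s $ i = 0. \<theta> $ i) + (\<Sum>i | \<theta>s $ i \<noteq> 0. (\<theta> $ i - \<theta>s $ i)\<^sup>2) / \<epsilon>"
    by (simp add: sum.distrib prob_simplex_sum_zero_set[OF assms(1,2)] sum_divide_distrib)
  also have "\<dots> \<le> (\<Sum>i | \<theta>s $ i = 0. \<theta> $ i) + (\<Sum>i\<in>UNIV. (\<theta> $ i - \<theta>s $ i)\<^sup>2) / \<epsilon>"
    using assms(3) by (intro add_left_mono divide_right_mono sum_mono2) auto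
  also have "(\<Sum>i\<in>UNIV. (\<theta> $ i - \<theta>s $ i)\<^sup>2) = (norm (\<theta> - \<theta>s))\<^sup>2"
    unfolding power2_norm_eq_inner inner_vec_def by (simp add: power2_eq_square)
  finally show ?thesis .
qed

section \<open>Decay of the objective away from its maximiser\<close>

lemma simplex_chart_sum: "(\<Sum>i\<in>UNIV. simplex_chart k x $ i) = 1"
  by (simp add: simplex_chart_def sum.remove[of UNIV k])

lemma prob_simplex_bounds:
  assumes "\<theta> \<in> prob_simplex"
  shows "0 \<le> \<theta> $ i" "\<theta> $ i \<le> 1" "norm \<theta> \<le> 1" "(\<Sum>i\<in>A. \<theta> $ i) \<le> 1"
proof -
  show 0: "0 \<le> \<theta> $ i" for i
    using assms by (simp add: prob_simplex_def)
  show 1: "(\<Sum>i\<in>A. \<theta> $ i) \<le> 1" for A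
    using assms sum_mono2[of UNIV A "\<lambda>i. \<theta> $ i"] 0 by (simp add: prob_simplex_def)
  show "\<theta> $ i \<le> 1"
    using 1[of "{i}"] by simp
  show "norm \<theta> \<le> 1"
    using assms norm_le_l1_cart[of \<theta>] by (simp add: prob_simplex_def)
qed

text \<open>Conditions (A1) to (A4) at a fixed maximiser; \<open>Hess\<close> is the Hessian at
  \<theta>* itself, not a matrix-valued map.\<close>

locale simplex_maximum =
  fixes H :: "real^'k::finite \<Rightarrow> real" and \<theta>s :: "real^'k" and U :: "(real^'k) set"
    and grad :: "real^'k \<Rightarrow> real^'k" and Hess :: "real^'k^'k"
    and lam :: "'k \<Rightarrow> real" and \<mu> :: real and Z :: "'k set"
  defines "Z \<equiv> {i. \<theta>s $ i = 0}"
  assumes theta_s: "\<theta>s \<in> prob_simplex"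
    and H_less: "\<theta> \<in> prob_simplex \<Longrightarrow> \<theta> \<noteq> \<theta>s \<Longrightarrow> H \<theta> < H \<theta>s"
    and cont: "continuous_on prob_simplex H"
    and U_open: "open U" and U_mem: "\<theta>s \<in> U"
    and grad_deriv: "x \<in> U \<Longrightarrow> (H has_derivative (\<lambda>h. grad x \<bullet> h)) (at x)"
    and hess_deriv: "(grad has_derivative (\<lambda>h. Hess *v h)) (at \<theta>s)"
    and KKT: "grad \<theta>s = (\<chi> i. (if i \<in> Z then - lam i else 0) + \<mu>)"
    and lam_pos: "i \<in> Z \<Longrightarrow> lam i > 0"
    and curv_neg: "d \<noteq> 0 \<Longrightarrow> (\<Sum>i\<in>UNIV. d $ i) = 0 \<Longrightarrow> (\<And>i. i \<in> Z \<Longrightarrow> d $ i = 0) \<Longrightarrow> d \<bullet> (Hess *v d) < 0"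
begin

lemma theta_s_zero: "i \<in> Z \<Longrightarrow> \<theta>s $ i = 0"
  by (simp add: Z_def)

lemma theta_s_pos: "i \<notin> Z \<Longrightarrow> \<theta>s $ i > 0"
  using prob_simplex_bounds(1)[OF theta_s, of i] by (auto simp: Z_def order_le_less)

text \<open>The multiplier \<mu> is paired with the coordinate sum of \<open>d\<close>, which
  vanishes.\<close>

lemma grad_inner_tangent:
  assumes "(\<Sum>i\<in>UNIV. d $ i) = 0"
  shows "grad \<theta>s \<bullet> d = - (\<Sum>i\<in>Z. lam i * d $ i)"
proof -
  have "grad \<theta>s \<bullet> d = (\<Sum>i\<in>UNIV. (if i \<in> Z then - lam i * d $ i else 0) + \<mu> * d $ i)"
    unfolding inner_vec_def KKT by (intro sum.cong) (auto simp: algebra_simps)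
  also have "\<dots> = (\<Sum>i\<in>UNIV. (if i \<in> Z then - lam i * d $ i else 0))"
    using assms by (simp add: sum.distrib flip: sum_distrib_left)
  also have "\<dots> = (\<Sum>i\<in>Z. - lam i * d $ i)"
    by (subst sum.inter_restrict[symmetric]) auto
  finally show ?thesis by (simp add: sum_negf)
qed

lemma continuous_curv: "continuous_on S (\<lambda>e. e \<bullet> (Hess *v e))"
  by (intro continuous_intros linear_continuous_on) (rule matrix_vector_mul_bounded_linear)

text \<open>On the unit sphere of the tangent space, (A4) makes the curvature negative wherever the
  penalty over \<open>Z\<close> vanishes, so \<open>compact_penalty\<close> applies. The form is
  homogeneous of degree two and the penalty of degree one, hence the additional factor
  \<open>norm d\<close>.\<close>

lemma curv_le:
  obtains c M where "0 < c" "0 < M"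
    "\<And>d. (\<Sum>i\<in>UNIV. d $ i) = 0 \<Longrightarrow>
      d \<bullet> (Hess *v d) \<le> - c * (norm d)\<^sup>2 + M * norm d * (\<Sum>i\<in>Z. \<bar>d $ i\<bar>)"
proof -
  let ?S = "{e::real^'k. norm e = 1 \<and> (\<Sum>i\<in>UNIV. e $ i) = 0}"
  have "?S = sphere 0 1 \<inter> {e. (\<Sum>i\<in>UNIV. e $ i) = 0}"
    by auto
  moreover have "closed {e::real^'k. (\<Sum>i\<in>UNIV. e $ i) = 0}"
    by (intro closed_Collect_eq continuous_intros)
  ultimately have S: "compact ?S"
    by (simp add: compact_Int_closed)
  have g: "continuous_on ?S (\<lambda>e. \<Sum>i\<in>Z. \<bar>e $ i\<bar>)"
    by (intro continuous_intros)
  have neg: "e \<bullet> (Hess *v e) < 0" if "e \<in> ?S" "(\<Sum>i\<in>Z. \<bar>e $ i\<bar>) = 0" for e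
    using that by (intro curv_neg) (auto simp: sum_nonneg_eq_0_iff)
  obtain c M where cM: "0 < c" "0 < M"
    "\<And>e. e \<in> ?S \<Longrightarrow> e \<bullet> (Hess *v e) \<le> - c + M * (\<Sum>i\<in>Z. \<bar>e $ i\<bar>)"
    by (rule compact_penalty[OF S continuous_curv g _ neg]) (auto intro: sum_nonneg that)
  have "d \<bullet> (Hess *v d) \<le> - c * (norm d)\<^sup>2 + M * norm d * (\<Sum>i\<in>Z. \<bar>d $ i\<bar>)"
    if d: "(\<Sum>i\<in>UNIV. d $ i) = 0" for d
  proof (cases "d = 0")
    case False
    define e where "e = (1 / norm d) *\<^sub>R d"
    have de: "d = norm d *\<^sub>R e"
      using False by (simp add: e_def)
    have "e \<in> ?S"
      using False d by (simp add: e_def flip: sum_divide_distrib)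
    then have "(norm d)\<^sup>2 * (e \<bullet> (Hess *v e)) \<le> (norm d)\<^sup>2 * (- c + M * (\<Sum>i\<in>Z. \<bar>e $ i\<bar>))"
      by (intro mult_left_mono cM) auto
    moreover have "d \<bullet> (Hess *v d) = (norm d)\<^sup>2 * (e \<bullet> (Hess *v e))"
      by (subst (1 2) de) (simp add: matrix_vector_mult_scaleR power2_eq_square)
    moreover have "(\<Sum>i\<in>Z. \<bar>d $ i\<bar>) = norm d * (\<Sum>i\<in>Z. \<bar>e $ i\<bar>)"
      by (subst (1) de) (simp add: abs_mult sum_distrib_left)
    ultimately show ?thesis
      by (simp add: algebra_simps power2_eq_square)
  qed simp
  with cM(1,2) show ?thesis by (rule that)
qed

lemma tangent_diff:
  "\<theta> \<in> prob_simplex \<Longrightarrow> (\<Sum>i\<in>UNIV. (\<theta> - \<theta>s) $ i) = 0"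
  using theta_s by (simp add: prob_simplex_def sum_subtractf)

text \<open>With \<open>h = \<theta> - \<theta>s\<close> and \<open>s\<close> the mass on
  \<open>Z\<close>, the gradient contributes at most \<open>- l * s\<close> and the curvature
  \<open>- c / 2 * (norm h)\<^sup>2\<close> plus a cross term \<open>M / 2 * norm h * s\<close>. For
  \<open>norm h < l / M\<close> the cross term costs at most half of the linear decay, and the
  Taylor remainder at most half of the quadratic decay.\<close>

lemma H_decay_local:
  obtains c \<rho> where "0 < c" "0 < \<rho>"
    "\<And>\<theta>. \<theta> \<in> prob_simplex \<Longrightarrow> norm (\<theta> - \<theta>s) < \<rho> \<Longrightarrow>
      H \<theta> - H \<theta>s \<le> - c * ((\<Sum>i\<in>Z. \<theta> $ i) + (norm (\<theta> - \<theta>s))\<^sup>2)"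
proof -
  obtain c M where c: "0 < c" and M: "0 < M" and curv: "\<And>d. (\<Sum>i\<in>UNIV. d $ i) = 0 \<Longrightarrow>
      d \<bullet> (Hess *v d) \<le> - c * (norm d)\<^sup>2 + M * norm d * (\<Sum>i\<in>Z. \<bar>d $ i\<bar>)"
    by (rule curv_le) (rule that)
  \<comment> \<open>Inserting 1 keeps the minimum defined when \<open>Z\<close> is empty, that is,
    for an interior maximiser.\<close>
  define l where "l = Min (insert 1 (lam ` Z))"
  have l: "0 < l" "\<And>i. i \<in> Z \<Longrightarrow> l \<le> lam i"
    using lam_pos by (auto simp: l_def)
  have "\<forall>\<^sub>F h in nhds 0. dist ((H (\<theta>s + h) - H \<theta>s - grad \<theta>s \<bullet> h - (h \<bullet> (Hess *v h)) / 2) / (norm h)\<^sup>2) 0 < c / 4"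
    using c by (intro tendstoD[OF second_order_Taylor[OF U_open U_mem grad_deriv hess_deriv]]) auto
  then obtain \<rho> where \<rho>: "0 < \<rho>" and T: "\<And>h. norm h < \<rho> \<Longrightarrow>
    \<bar>(H (\<theta>s + h) - H \<theta>s - grad \<theta>s \<bullet> h - (h \<bullet> (Hess *v h)) / 2) / (norm h)\<^sup>2\<bar> < c / 4"
    unfolding eventually_nhds_metric by auto
  show ?thesis
  proof (rule that[of "min (l / 2) (c / 4)" "min \<rho> (l / M)"])
    fix \<theta> assume \<theta>: "\<theta> \<in> prob_simplex" and near: "norm (\<theta> - \<theta>s) < min \<rho> (l / M)"
    define h where "h = \<theta> - \<theta>s"
    define s where "s = (\<Sum>i\<in>Z. \<theta> $ i)"
    have s: "0 \<le> s"
      unfolding s_def using prob_simplex_bounds(1)[OF \<theta>] by (intro sum_nonneg)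
    have h0: "(\<Sum>i\<in>UNIV. h $ i) = 0"
      using tangent_diff[OF \<theta>] by (simp add: h_def)
    have hZ: "h $ i = \<theta> $ i" if "i \<in> Z" for i
      using that by (simp add: h_def theta_s_zero)
    have R: "H \<theta> - H \<theta>s - grad \<theta>s \<bullet> h - (h \<bullet> (Hess *v h)) / 2 \<le> c / 4 * (norm h)\<^sup>2"
    proof (cases "h = 0")
      case False
      have "\<theta>s + h = \<theta>" "norm h < \<rho>"
        using near by (simp_all add: h_def)
      with T[of h] False have "\<bar>H \<theta> - H \<theta>s - grad \<theta>s \<bullet> h - (h \<bullet> (Hess *v h)) / 2\<bar> < c / 4 * (norm h)\<^sup>2"
        by (simp add: abs_divide pos_divide_less_eq)
      then show ?thesis by linarith
    qed (simp add: h_def)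
    have G: "grad \<theta>s \<bullet> h \<le> - l * s"
    proof -
      have "l * s \<le> (\<Sum>i\<in>Z. lam i * h $ i)"
        unfolding s_def sum_distrib_left using l(2) prob_simplex_bounds(1)[OF \<theta>]
        by (intro sum_mono) (simp add: hZ mult_right_mono)
      then show ?thesis by (simp add: grad_inner_tangent[OF h0])
    qed
    have Q: "h \<bullet> (Hess *v h) \<le> - c * (norm h)\<^sup>2 + M * norm h * s"
      using curv[OF h0] prob_simplex_bounds(1)[OF \<theta>] by (simp add: s_def hZ)
    have "M * norm h \<le> l"
      using near M by (simp add: h_def less_divide_eq mult.commute less_imp_le)
    then have "M * norm h * s \<le> l * s"
      using s by (rule mult_right_mono)
    with R G Q have "H \<theta> - H \<theta>s \<le> - (l / 2) * s - (c / 4) * (norm h)\<^sup>2"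
      by (simp add: field_simps)
    moreover have "min (l / 2) (c / 4) * s \<le> l / 2 * s" "min (l / 2) (c / 4) * (norm h)\<^sup>2 \<le> c / 4 * (norm h)\<^sup>2"
      using s by (intro mult_right_mono; simp)+
    ultimately show "H \<theta> - H \<theta>s \<le> - min (l / 2) (c / 4) * ((\<Sum>i\<in>Z. \<theta> $ i) + (norm (\<theta> - \<theta>s))\<^sup>2)"
      by (simp add: algebra_simps s_def h_def)
  qed (use c l M \<rho> in auto)
qed

lemma H_decay:
  obtains c where "0 < c"
    "\<And>\<theta>. \<theta> \<in> prob_simplex \<Longrightarrow> H \<theta> - H \<theta>s \<le> - c * ((\<Sum>i\<in>Z. \<theta> $ i) + (norm (\<theta> - \<theta>s))\<^sup>2)"
proof -
  obtain c \<rho> where c: "0 < c" and \<rho>: "0 < \<rho>" and near: "\<And>\<theta>. \<theta> \<in> prob_simplex \<Longrightarrow> norm (\<theta> - \<theta>s) < \<rho> \<Longrightarrow>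
      H \<theta> - H \<theta>s \<le> - c * ((\<Sum>i\<in>Z. \<theta> $ i) + (norm (\<theta> - \<theta>s))\<^sup>2)"
    by (rule H_decay_local) (rule that)
  let ?S = "prob_simplex - ball \<theta>s \<rho>"
  have S: "compact ?S"
    by (intro compact_diff compact_prob_simplex open_ball)
  have f: "continuous_on ?S (\<lambda>\<theta>. H \<theta> - H \<theta>s)"
    by (intro continuous_intros continuous_on_subset[OF cont]) auto
  have neg: "H \<theta> - H \<theta>s < 0" if "\<theta> \<in> ?S" for \<theta>
    using H_less[of \<theta>] that \<rho> by (cases "\<theta> = \<theta>s") auto
  \<comment> \<open>With penalty 0, compactness yields a uniform gap outside the ball.\<close>
  obtain c' where c': "0 < c'" and far: "\<And>\<theta>. \<theta> \<in> ?S \<Longrightarrow> H \<theta> - H \<theta>s \<le> - c'"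
    by (rule compact_penalty[OF S f continuous_on_const[of _ 0] _ neg]) (auto intro: that)
  show ?thesis
  \<comment> \<open>On the simplex \<open>Q\<close> is at most 1 + 4 = 5, so the gap
    \<open>c'\<close> is at least \<open>c' / 5 * Q\<close>.\<close>
  proof (rule that[of "min c (c' / 5)"])
    fix \<theta> :: "real^'k" assume \<theta>: "\<theta> \<in> prob_simplex"
    define Q where "Q = (\<Sum>i\<in>Z. \<theta> $ i) + (norm (\<theta> - \<theta>s))\<^sup>2"
    have "0 \<le> Q"
      unfolding Q_def using prob_simplex_bounds(1)[OF \<theta>] by (intro add_nonneg_nonneg sum_nonneg) auto
    have "norm (\<theta> - \<theta>s) \<le> 2"
      using norm_triangle_ineq4[of \<theta> \<theta>s] prob_simplex_bounds(3)[OF \<theta>] prob_simplex_bounds(3)[OF theta_s] by simp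
    then have "(norm (\<theta> - \<theta>s))\<^sup>2 \<le> 2\<^sup>2"
      by (intro power_mono) auto
    then have Q5: "Q \<le> 5"
      unfolding Q_def using prob_simplex_bounds(4)[OF \<theta>, of Z] by simp
    show "H \<theta> - H \<theta>s \<le> - min c (c' / 5) * Q"
    proof (cases "norm (\<theta> - \<theta>s) < \<rho>")
      case True
      have "min c (c' / 5) * Q \<le> c * Q"
        using \<open>0 \<le> Q\<close> by (intro mult_right_mono) auto
      then show ?thesis using near[OF \<theta> True] by (simp add: Q_def)
    next
      case False
      have "min c (c' / 5) * Q \<le> c' / 5 * 5"
        using \<open>0 \<le> Q\<close> Q5 c' by (intro mult_mono) auto
      then show ?thesis
        using far[of \<theta>] False \<theta> by (simp add: dist_norm norm_minus_commute)
    qed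
  qed (use c c' in auto)
qed

end

section \<open>The rescaled integrand\<close>

text \<open>\<open>k\<close> is the eliminated coordinate; as it lies outside \<open>Z\<close>, all
  coordinates in \<open>Z\<close> are chart coordinates and can be scaled by
  \<open>1 / n\<close>.\<close>

locale simplex_laplace = simplex_maximum H \<theta>s U grad Hess lam \<mu> Z
  for H :: "real^'k::finite \<Rightarrow> real" and \<theta>s U grad Hess lam \<mu> Z +
  fixes \<alpha> :: "'k \<Rightarrow> real" and \<epsilon> \<gamma> :: real and k :: 'k
  assumes alpha_pos: "\<alpha> i > 0"
    and eps_pos: "0 < \<epsilon>" and eps_lt: "\<theta>s $ i > 0 \<Longrightarrow> \<epsilon> < \<theta>s $ i"
    and gamma: "0 < \<gamma>" "\<gamma> < 1"
    and k: "k \<notin> Z"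
begin

definition trunc :: "(real^'k) set" where
  "trunc = {\<theta>\<in>prob_simplex. \<forall>i. \<theta>s $ i > 0 \<longrightarrow> \<theta> $ i \<ge> \<epsilon>}"

text \<open>The integrand of the Dirichlet expectation without the factor
  \<open>1 / multi_beta \<alpha>\<close>, written on the ambient space so that it can be read in any
  chart.\<close>

definition weight :: "real \<Rightarrow> real^'k \<Rightarrow> real" where
  "weight n \<theta> = indicator prob_simplex \<theta> * (\<Prod>i\<in>UNIV. \<theta> $ i powr (\<alpha> i - 1)) *
     (exp (2 * n * H \<theta> + n powr \<gamma> * KL \<theta>s \<theta>) * indicator trunc \<theta>)"

definition rate :: "real \<Rightarrow> 'k \<Rightarrow> real" where
  "rate n i = (if i \<in> Z then 1 / n else 1 / sqrt n)"

definition point :: "real \<Rightarrow> ('k \<Rightarrow> real) \<Rightarrow> real^'k" where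
  "point n y = simplex_chart k (\<lambda>i. \<theta>s $ i + rate n i * y i)"

text \<open>The linear part of \<open>simplex_chart k\<close>.\<close>

definition tangent :: "('k \<Rightarrow> real) \<Rightarrow> real^'k" where
  "tangent w = (\<chi> i. if i = k then - (\<Sum>j\<in>UNIV - {k}. w j) else w i)"

text \<open>The displacement from \<open>\<theta>*\<close> is \<open>inner_dir y / sqrt n + outer_dir y / n\<close>: the first part stays in
  the face of the simplex containing \<open>\<theta>*\<close>, the second leaves it.\<close>
definition inner_dir :: "('k \<Rightarrow> real) \<Rightarrow> real^'k" where
  "inner_dir y = tangent (\<lambda>i. if i \<in> Z then 0 else y i)"

definition outer_dir :: "('k \<Rightarrow> real) \<Rightarrow> real^'k" where
  "outer_dir y = tangent (\<lambda>i. if i \<in> Z then y i else 0)"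

text \<open>The prefactors cancel the powers of \<open>n\<close> coming from
  \<open>(y i / n) powr (\<alpha> i - 1)\<close> and the peak value of the exponential; the Jacobian
  is kept apart, in \<open>prod_rate\<close>.\<close>

definition rescaled :: "real \<Rightarrow> ('k \<Rightarrow> real) \<Rightarrow> real" where
  "rescaled n y = (\<Prod>i\<in>Z. n powr (\<alpha> i - 1)) * exp (- 2 * n * H \<theta>s) * weight n (point n y)"

text \<open>By \<open>grad_inner_tangent\<close> the linear part of the exponent is minus the sum of
  \<open>lam i * y i\<close> over \<open>Z\<close>, which gives Gamma kernels; the quadratic part is
  the Gaussian on the face.\<close>

definition limit :: "('k \<Rightarrow> real) \<Rightarrow> real" where
  "limit y = (\<Prod>i\<in>Z. indicator {0<..} (y i) * y i powr (\<alpha> i - 1)) *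
     (\<Prod>i\<in>- Z. \<theta>s $ i powr (\<alpha> i - 1)) *
     exp (2 * (grad \<theta>s \<bullet> outer_dir y + inner_dir y \<bullet> (Hess *v inner_dir y) / 2))"

lemma point_nth: "i \<noteq> k \<Longrightarrow> point n y $ i = \<theta>s $ i + rate n i * y i"
  by (simp add: point_def simplex_chart_def)

lemma point_nth_Z: "i \<in> Z \<Longrightarrow> point n y $ i = y i / n"
  using k by (subst point_nth) (auto simp: theta_s_zero rate_def)

lemma sum_tangent: "(\<Sum>i\<in>UNIV. tangent w $ i) = 0"
  by (simp add: tangent_def sum.remove[of UNIV k])

lemma point_eq: "point n y = \<theta>s + ((1 / sqrt n) *\<^sub>R inner_dir y + (1 / n) *\<^sub>R outer_dir y)"
proof -
  have "1 - (\<Sum>j\<in>UNIV - {k}. \<theta>s $ j) = \<theta>s $ k"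
    using theta_s by (simp add: prob_simplex_def sum.remove[of UNIV k])
  then have k': "1 - (\<Sum>j\<in>UNIV - {k}. \<theta>s $ j + rate n j * y j) = \<theta>s $ k - (\<Sum>j\<in>UNIV - {k}. rate n j * y j)"
    by (simp add: sum.distrib)
  have "(\<Sum>j\<in>UNIV - {k}. rate n j * y j) =
    (1 / sqrt n) * (\<Sum>j\<in>UNIV - {k}. if j \<in> Z then 0 else y j) + (1 / n) * (\<Sum>j\<in>UNIV - {k}. if j \<in> Z then y j else 0)"
    unfolding sum_distrib_left sum.distrib[symmetric] by (intro sum.cong) (auto simp: rate_def)
  with k' show ?thesis
    unfolding vec_eq_iff point_def simplex_chart_def inner_dir_def outer_dir_def tangent_def
    by (auto simp: rate_def)
qed

text \<open>Directions inside the face have no component along \<open>Z\<close>. Hence the term of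
  order sqrt n in the scaled increment of \<open>H\<close> is absent.\<close>

lemma grad_inner_dir: "grad \<theta>s \<bullet> inner_dir y = 0"
proof -
  have "inner_dir y $ i = 0" if "i \<in> Z" for i
    using that k by (auto simp: inner_dir_def tangent_def)
  then show ?thesis
    using grad_inner_tangent[of "inner_dir y"] by (simp add: inner_dir_def sum_tangent)
qed

lemma point_tendsto: "((\<lambda>n. point n y) \<longlongrightarrow> \<theta>s) at_top"
proof -
  have "((\<lambda>n::real. 1 / sqrt n) \<longlongrightarrow> 0) at_top" "((\<lambda>n::real. 1 / n) \<longlongrightarrow> 0) at_top"
    by real_asymp+
  then have "((\<lambda>n. \<theta>s + ((1 / sqrt n) *\<^sub>R inner_dir y + (1 / n) *\<^sub>R outer_dir y)) \<longlongrightarrow>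
      \<theta>s + (0 *\<^sub>R inner_dir y + 0 *\<^sub>R outer_dir y)) at_top"
    by (intro tendsto_intros)
  then show ?thesis by (simp add: point_eq)
qed

lemma H_increment_tendsto:
  "((\<lambda>n. n * (H (point n y) - H \<theta>s)) \<longlongrightarrow>
    grad \<theta>s \<bullet> outer_dir y + inner_dir y \<bullet> (Hess *v inner_dir y) / 2) at_top"
  unfolding point_eq
  by (rule scaled_increment_tendsto[OF U_open U_mem grad_deriv hess_deriv grad_inner_dir])

section \<open>Pointwise limit of the rescaled integrand\<close>

text \<open>Inside the truncated simplex the indicators are 1 and the powers of \<open>n\<close>
  cancel; the remaining factors can be bounded and passed to the limit one by one.\<close>

lemma rescaled_on_trunc:
  assumes n: "0 < n" and y: "\<forall>i\<in>Z. 0 < y i" and tr: "point n y \<in> trunc"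
  shows "rescaled n y = (\<Prod>i\<in>Z. y i powr (\<alpha> i - 1)) * (\<Prod>i\<in>- Z. point n y $ i powr (\<alpha> i - 1)) *
    exp (2 * (n * (H (point n y) - H \<theta>s)) + n powr \<gamma> * KL \<theta>s (point n y))"
proof -
  have split: "(\<Prod>i\<in>UNIV. point n y $ i powr (\<alpha> i - 1)) =
    (\<Prod>i\<in>Z. point n y $ i powr (\<alpha> i - 1)) * (\<Prod>i\<in>- Z. point n y $ i powr (\<alpha> i - 1))"
    by (subst prod.union_disjoint[symmetric]) auto
  have scale: "(\<Prod>i\<in>Z. n powr (\<alpha> i - 1)) * (\<Prod>i\<in>Z. point n y $ i powr (\<alpha> i - 1)) = (\<Prod>i\<in>Z. y i powr (\<alpha> i - 1))"
    unfolding prod.distrib[symmetric]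
  proof (rule prod.cong[OF refl])
    fix i assume "i \<in> Z"
    then show "n powr (\<alpha> i - 1) * point n y $ i powr (\<alpha> i - 1) = y i powr (\<alpha> i - 1)"
      using n y by (simp add: point_nth_Z powr_divide less_imp_le)
  qed
  have expo: "exp (- 2 * n * H \<theta>s) * exp (2 * n * H (point n y) + n powr \<gamma> * KL \<theta>s (point n y)) =
    exp (2 * (n * (H (point n y) - H \<theta>s)) + n powr \<gamma> * KL \<theta>s (point n y))"
    by (simp add: exp_add[symmetric] algebra_simps)
  have "point n y \<in> prob_simplex"
    using tr by (simp add: trunc_def)
  then have "rescaled n y = (\<Prod>i\<in>Z. n powr (\<alpha> i - 1)) * exp (- 2 * n * H \<theta>s) *
    ((\<Prod>i\<in>UNIV. point n y $ i powr (\<alpha> i - 1)) * exp (2 * n * H (point n y) + n powr \<gamma> * KL \<theta>s (point n y)))"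
    using tr by (simp add: rescaled_def weight_def)
  also have "\<dots> = ((\<Prod>i\<in>Z. n powr (\<alpha> i - 1)) * (\<Prod>i\<in>Z. point n y $ i powr (\<alpha> i - 1))) *
    (\<Prod>i\<in>- Z. point n y $ i powr (\<alpha> i - 1)) *
    (exp (- 2 * n * H \<theta>s) * exp (2 * n * H (point n y) + n powr \<gamma> * KL \<theta>s (point n y)))"
    unfolding split by (simp only: mult_ac)
  finally show ?thesis
    unfolding scale expo .
qed

lemma rescaled_nonneg: "0 \<le> rescaled n y"
  by (auto simp: rescaled_def weight_def indicator_def intro!: mult_nonneg_nonneg prod_nonneg)

lemma rescaled_eq_0:
  assumes n: "0 < n" and i: "i \<in> Z" "y i \<le> 0"
  shows "rescaled n y = 0"
proof (cases "y i = 0")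
  case True
  \<comment> \<open>\<open>0 powr a\<close> is 0 for every exponent, even a negative one, in
    agreement with the open half-line in \<open>limit\<close>.\<close>
  then have "point n y $ i powr (\<alpha> i - 1) = 0"
    using i by (simp add: point_nth_Z)
  then have "(\<Prod>i\<in>UNIV. point n y $ i powr (\<alpha> i - 1)) = 0"
    by (intro prod_zero) auto
  then show ?thesis by (simp add: rescaled_def weight_def)
next
  case False
  then have "point n y $ i < 0"
    using i n by (simp add: point_nth_Z divide_less_0_iff)
  then have "point n y \<notin> prob_simplex"
    by (auto simp: prob_simplex_def not_le intro!: exI[of _ i])
  then show ?thesis by (simp add: rescaled_def weight_def)
qed

text \<open>The points converge to \<theta>*, where the constraints off \<open>Z\<close> hold
  strictly because \<epsilon> is below every positive coordinate; coordinates in \<open>Z\<close>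
  equal \<open>y i / n\<close>.\<close>

lemma eventually_point_in_trunc:
  assumes y: "\<forall>i\<in>Z. 0 < y i"
  shows "\<forall>\<^sub>F n in at_top. point n y \<in> trunc"
proof -
  have "\<forall>\<^sub>F n in at_top. \<epsilon> < point n y $ i" if "i \<notin> Z" for i
    using eps_lt[OF theta_s_pos[OF that]]
    by (intro order_tendstoD(1)[OF tendsto_vec_nth[OF point_tendsto]])
  then have "\<forall>\<^sub>F n in at_top. \<forall>i\<in>- Z. \<epsilon> < point n y $ i"
    by (intro eventually_ball_finite) auto
  then show ?thesis
    using eventually_gt_at_top[of 0]
  proof eventually_elim
    case (elim n)
    have "0 \<le> point n y $ i" for i
    proof (cases "i \<in> Z")
      case False
      then have "\<epsilon> < point n y $ i" using elim by blast
      then show ?thesis using eps_pos by simp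
    qed (use elim y in \<open>simp add: point_nth_Z less_imp_le\<close>)
    moreover have "\<epsilon> \<le> point n y $ i" if "\<theta>s $ i > 0" for i
      using elim that theta_s_zero[of i] by (cases "i \<in> Z") (auto simp: less_imp_le)
    ultimately show ?case
      by (auto simp: trunc_def prob_simplex_def) (simp add: point_def simplex_chart_sum)
  qed
qed

lemma sum_point_Z: "(\<Sum>i\<in>Z. point n y $ i) = (\<Sum>i\<in>Z. y i) / n"
  by (simp add: point_nth_Z sum_divide_distrib)

lemma KL_bounds:
  assumes "\<theta> \<in> trunc"
  shows "0 \<le> KL \<theta>s \<theta>" "KL \<theta>s \<theta> \<le> (\<Sum>i\<in>Z. \<theta> $ i) + (norm (\<theta> - \<theta>s))\<^sup>2 / \<epsilon>"
proof -
  have \<theta>: "\<theta> \<in> prob_simplex" and e: "\<And>i. \<theta>s $ i > 0 \<Longrightarrow> \<epsilon> \<le> \<theta> $ i"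
    using assms by (auto simp: trunc_def)
  have "0 \<le> (\<Sum>i\<in>Z. \<theta> $ i)"
    using prob_simplex_bounds(1)[OF \<theta>] by (intro sum_nonneg)
  also have "\<dots> \<le> KL \<theta>s \<theta>"
    unfolding Z_def using e eps_pos by (intro KL_ge_zero_set_mass theta_s \<theta>) (force intro: less_le_trans)
  finally show "0 \<le> KL \<theta>s \<theta>" .
  show "KL \<theta>s \<theta> \<le> (\<Sum>i\<in>Z. \<theta> $ i) + (norm (\<theta> - \<theta>s))\<^sup>2 / \<epsilon>"
    unfolding Z_def by (intro KL_le_zero_set_mass theta_s \<theta> eps_pos e)
qed

text \<open>For fixed \<open>y\<close> both the mass on \<open>Z\<close> and the squared distance to
  \<theta>* are O(1/n), so the term is of order \<open>n powr (\<gamma> - 1)\<close>.\<close>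

lemma KL_term_tendsto:
  assumes y: "\<forall>i\<in>Z. 0 < y i"
  shows "((\<lambda>n. n powr \<gamma> * KL \<theta>s (point n y)) \<longlongrightarrow> 0) at_top"
proof (rule tendsto_sandwich)
  let ?z = "\<lambda>n. inner_dir y + (1 / sqrt n) *\<^sub>R outer_dir y"
  let ?u = "\<lambda>n. (n powr \<gamma> / n) * ((\<Sum>i\<in>Z. y i) + (norm (?z n))\<^sup>2 / \<epsilon>)"
  show "\<forall>\<^sub>F n in at_top. 0 \<le> n powr \<gamma> * KL \<theta>s (point n y)"
    using eventually_point_in_trunc[OF y] by eventually_elim (auto simp: KL_bounds)
  show "\<forall>\<^sub>F n in at_top. n powr \<gamma> * KL \<theta>s (point n y) \<le> ?u n"
    using eventually_point_in_trunc[OF y] eventually_gt_at_top[of 0]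
  proof eventually_elim
    case (elim n)
    have "point n y - \<theta>s = (1 / sqrt n) *\<^sub>R ?z n"
      using elim by (simp add: point_eq scaleR_add_right)
    then have "(norm (point n y - \<theta>s))\<^sup>2 = (norm (?z n))\<^sup>2 / n"
      using elim by (simp add: power_divide)
    then have "KL \<theta>s (point n y) \<le> (\<Sum>i\<in>Z. y i) / n + (norm (?z n))\<^sup>2 / n / \<epsilon>"
      using KL_bounds(2)[OF elim(1)] by (simp add: sum_point_Z)
    then have "n powr \<gamma> * KL \<theta>s (point n y) \<le> n powr \<gamma> * ((\<Sum>i\<in>Z. y i) / n + (norm (?z n))\<^sup>2 / n / \<epsilon>)"
      by (intro mult_left_mono) auto
    also have "\<dots> = ?u n"
      by (simp add: algebra_simps add_divide_distrib)
    finally show ?case .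
  qed
  have "((\<lambda>n::real. n powr \<gamma> / n) \<longlongrightarrow> 0) at_top" "((\<lambda>n::real. 1 / sqrt n) \<longlongrightarrow> 0) at_top"
    using gamma by real_asymp+
  then have "(?u \<longlongrightarrow> 0 * ((\<Sum>i\<in>Z. y i) + (norm (inner_dir y + 0 *\<^sub>R outer_dir y))\<^sup>2 / \<epsilon>)) at_top"
    using eps_pos by (intro tendsto_intros) auto
  then show "(?u \<longlongrightarrow> 0) at_top" by simp
qed simp

lemma rescaled_tendsto: "((\<lambda>n. rescaled n y) \<longlongrightarrow> limit y) at_top"
proof (cases "\<forall>i\<in>Z. 0 < y i")
  case True
  note y = True
  have "((\<lambda>n. (\<Prod>i\<in>Z. y i powr (\<alpha> i - 1)) * (\<Prod>i\<in>- Z. point n y $ i powr (\<alpha> i - 1)) *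
      exp (2 * (n * (H (point n y) - H \<theta>s)) + n powr \<gamma> * KL \<theta>s (point n y))) \<longlongrightarrow>
    (\<Prod>i\<in>Z. y i powr (\<alpha> i - 1)) * (\<Prod>i\<in>- Z. \<theta>s $ i powr (\<alpha> i - 1)) *
      exp (2 * (grad \<theta>s \<bullet> outer_dir y + inner_dir y \<bullet> (Hess *v inner_dir y) / 2) + 0)) at_top"
    using theta_s_pos
    by (intro tendsto_intros H_increment_tendsto KL_term_tendsto point_tendsto y) force+
  moreover have "\<forall>\<^sub>F n in at_top. (\<Prod>i\<in>Z. y i powr (\<alpha> i - 1)) * (\<Prod>i\<in>- Z. point n y $ i powr (\<alpha> i - 1)) *
      exp (2 * (n * (H (point n y) - H \<theta>s)) + n powr \<gamma> * KL \<theta>s (point n y)) = rescaled n y"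
    using eventually_point_in_trunc[OF y] eventually_gt_at_top[of 0]
    by eventually_elim (simp add: rescaled_on_trunc y)
  ultimately have "((\<lambda>n. rescaled n y) \<longlongrightarrow> (\<Prod>i\<in>Z. y i powr (\<alpha> i - 1)) * (\<Prod>i\<in>- Z. \<theta>s $ i powr (\<alpha> i - 1)) *
      exp (2 * (grad \<theta>s \<bullet> outer_dir y + inner_dir y \<bullet> (Hess *v inner_dir y) / 2) + 0)) at_top"
    by (rule Lim_transform_eventually)
  then show ?thesis
    using True by (simp add: limit_def)
next
  case False
  then obtain i where i: "i \<in> Z" "y i \<le> 0" by (auto simp: not_less)
  then have "limit y = 0"
    by (auto simp: limit_def intro!: prod_zero bexI[of _ i])
  moreover have "\<forall>\<^sub>F n in at_top. rescaled n y = 0"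
    using eventually_gt_at_top[of 0] by eventually_elim (simp add: rescaled_eq_0[of _ i y] i)
  ultimately show ?thesis
    by (simp add: tendsto_eventually)
qed

section \<open>The integrable majorant\<close>

text \<open>A product over coordinates, so that integrability reduces to the one-dimensional
  kernels. The constant bounds the density factors off \<open>Z\<close>, where the coordinates lie
  between \<epsilon> and 1, whatever the sign of \<open>\<alpha> i - 1\<close>.\<close>

definition envelope :: "real \<Rightarrow> ('k \<Rightarrow> real) \<Rightarrow> real" where
  "envelope c y = (\<Prod>i\<in>- Z. max 1 (\<epsilon> powr (\<alpha> i - 1))) *
     (\<Prod>i\<in>UNIV - {k}. if i \<in> Z then indicator {0<..} (y i) * (y i powr (\<alpha> i - 1) * exp (- c * y i))
        else exp (- c * (y i)\<^sup>2))"

lemma envelope_nonneg: "0 \<le> envelope c y"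
  unfolding envelope_def by (intro mult_nonneg_nonneg prod_nonneg) (auto simp: le_max_iff_disj)

lemma integrable_envelope:
  assumes "0 < c"
  shows "integrable (PiM (UNIV - {k}) (\<lambda>_. lborel)) (envelope c)"
proof -
  interpret product_sigma_finite "\<lambda>_::'k. lborel :: real measure"
    by (rule product_sigma_finite_lborel)
  have "integrable lborel (\<lambda>u. if i \<in> Z then indicator {0<..} u * (u powr (\<alpha> i - 1) * exp (- c * u))
        else exp (- c * u\<^sup>2))" for i
    using integrable_gamma_kernel[OF alpha_pos assms] integrable_gaussian_kernel[OF assms]
    by (cases "i \<in> Z") simp_all
  then show ?thesis
    unfolding envelope_def
    by (intro integrable_mult_right product_integrable_prod
        [where f="\<lambda>i u. if i \<in> Z then indicator {0<..} u * (u powr (\<alpha> i - 1) * exp (- c * u))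
        else exp (- c * u\<^sup>2)"]) auto
qed

lemma envelope_eq:
  assumes y: "\<forall>i\<in>Z. 0 < y i"
  shows "envelope c y = (\<Prod>i\<in>- Z. max 1 (\<epsilon> powr (\<alpha> i - 1))) * (\<Prod>i\<in>Z. y i powr (\<alpha> i - 1)) *
    exp (- c * ((\<Sum>i\<in>Z. y i) + (\<Sum>i\<in>UNIV - {k} - Z. (y i)\<^sup>2)))"
proof -
  have I: "UNIV - {k} = Z \<union> (UNIV - {k} - Z)" "Z \<inter> (UNIV - {k} - Z) = {}"
    using k by auto
  have "(\<Prod>i\<in>UNIV - {k}. if i \<in> Z then indicator {0<..} (y i) * (y i powr (\<alpha> i - 1) * exp (- c * y i))
        else exp (- c * (y i)\<^sup>2)) =
     (\<Prod>i\<in>Z. y i powr (\<alpha> i - 1) * exp (- c * y i)) * (\<Prod>i\<in>UNIV - {k} - Z. exp (- c * (y i)\<^sup>2))"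
    by (subst I(1), subst prod.union_disjoint[OF _ _ I(2)]) (auto simp: y)
  also have "\<dots> = (\<Prod>i\<in>Z. y i powr (\<alpha> i - 1)) * (exp (\<Sum>i\<in>Z. - c * y i) * exp (\<Sum>i\<in>UNIV - {k} - Z. - c * (y i)\<^sup>2))"
    by (simp add: prod.distrib exp_sum)
  also have "exp (\<Sum>i\<in>Z. - c * y i) * exp (\<Sum>i\<in>UNIV - {k} - Z. - c * (y i)\<^sup>2) =
    exp (- c * ((\<Sum>i\<in>Z. y i) + (\<Sum>i\<in>UNIV - {k} - Z. (y i)\<^sup>2)))"
    by (simp add: exp_add[symmetric] sum_distrib_left algebra_simps sum_negf)
  finally show ?thesis
    by (simp add: envelope_def)
qed

text \<open>With \<open>s\<close> the mass on \<open>Z\<close> and \<open>d\<close> the squared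
  distance to \<theta>*, \<open>H_decay\<close> gives an exponent of at most
  \<open>- 2 * c * n * (s + d)\<close>, and the divergence returns at most
  \<open>c * n * (s + d)\<close> as soon as \<open>n powr \<gamma> / n * A < c\<close>. This
  threshold on \<open>n\<close> does not depend on \<open>y\<close>.\<close>

lemma rescaled_le_envelope:
  obtains c where "0 < c" "\<forall>\<^sub>F n in at_top. \<forall>y. rescaled n y \<le> envelope c y"
proof -
  obtain c where c: "0 < c" and decay: "\<And>\<theta>. \<theta> \<in> prob_simplex \<Longrightarrow>
      H \<theta> - H \<theta>s \<le> - c * ((\<Sum>i\<in>Z. \<theta> $ i) + (norm (\<theta> - \<theta>s))\<^sup>2)"
    by (rule H_decay) (rule that)
  \<comment> \<open>Dominates both coefficients, 1 of \<open>s\<close> and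
    \<open>1 / \<epsilon>\<close> of \<open>d\<close>, in the upper bound on the divergence.\<close>
  define A where "A = max 1 (1 / \<epsilon>)"
  have "((\<lambda>n::real. n powr \<gamma> / n * A) \<longlongrightarrow> 0 * A) at_top"
    by (rule tendsto_mult_right) (use gamma in real_asymp)
  then have "\<forall>\<^sub>F n in at_top. n powr \<gamma> / n * A < c"
    using c by (intro order_tendstoD(2)) auto
  then have "\<forall>\<^sub>F n in at_top. \<forall>y. rescaled n y \<le> envelope c y"
    using eventually_gt_at_top[of 0]
  proof eventually_elim
    case (elim n)
    have nA: "n powr \<gamma> * A \<le> c * n"
      using elim by (simp add: field_simps)
    show ?case
    proof
      fix y
      show "rescaled n y \<le> envelope c y"
      proof (cases "point n y \<in> trunc \<and> (\<forall>i\<in>Z. 0 < y i)")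
        case False
        then have "rescaled n y = 0"
          using rescaled_eq_0[OF elim(2), of _ y] by (auto simp: not_less rescaled_def weight_def)
        then show ?thesis by (simp add: envelope_nonneg)
      next
        case True
        then have tr: "point n y \<in> trunc" and y: "\<forall>i\<in>Z. 0 < y i" by auto
        let ?\<theta> = "point n y"
        have \<theta>: "?\<theta> \<in> prob_simplex" and \<epsilon>\<theta>: "\<And>i. i \<notin> Z \<Longrightarrow> \<epsilon> \<le> ?\<theta> $ i"
          using tr theta_s_pos by (auto simp: trunc_def)
        define s where "s = (\<Sum>i\<in>Z. ?\<theta> $ i)"
        define d where "d = (norm (?\<theta> - \<theta>s))\<^sup>2"
        have s: "0 \<le> s"
          unfolding s_def using prob_simplex_bounds(1)[OF \<theta>] by (intro sum_nonneg)
        have d: "0 \<le> d" by (simp add: d_def)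
        have "KL \<theta>s ?\<theta> \<le> s + d / \<epsilon>"
          using KL_bounds(2)[OF tr] by (simp add: s_def d_def)
        also have "\<dots> \<le> A * s + A * d"
        proof (rule add_mono)
          show "s \<le> A * s" using mult_right_mono[of 1 A s] s by (simp add: A_def)
          show "d / \<epsilon> \<le> A * d" using mult_right_mono[of "1 / \<epsilon>" A d] d by (simp add: A_def)
        qed
        finally have "n powr \<gamma> * KL \<theta>s ?\<theta> \<le> n powr \<gamma> * (A * (s + d))"
          by (intro mult_left_mono) (auto simp: algebra_simps)
        also have "\<dots> \<le> c * n * (s + d)"
          using mult_right_mono[OF nA, of "s + d"] s d by (simp add: mult.assoc)
        finally have KL: "n powr \<gamma> * KL \<theta>s ?\<theta> \<le> c * n * (s + d)" .
        have "n * (H ?\<theta> - H \<theta>s) \<le> n * (- c * (s + d))"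
          using decay[OF \<theta>] elim by (intro mult_left_mono) (auto simp: s_def d_def)
        with KL have "2 * (n * (H ?\<theta> - H \<theta>s)) + n powr \<gamma> * KL \<theta>s ?\<theta> \<le> - c * (n * s + n * d)"
          by (simp add: algebra_simps)
        also have "n * s = (\<Sum>i\<in>Z. y i)"
          using elim by (simp add: s_def sum_point_Z)
        also have "- c * ((\<Sum>i\<in>Z. y i) + n * d) \<le> - c * ((\<Sum>i\<in>Z. y i) + (\<Sum>i\<in>UNIV - {k} - Z. (y i)\<^sup>2))"
        proof -
          \<comment> \<open>Chart coordinates off \<open>Z\<close> are displaced by
            \<open>y i / sqrt n\<close>; adding the squares for \<open>k\<close> and
            \<open>Z\<close> only increases the sum.\<close>
          have "(\<Sum>i\<in>UNIV - {k} - Z. (y i)\<^sup>2) = n * (\<Sum>i\<in>UNIV - {k} - Z. ((?\<theta> - \<theta>s) $ i)\<^sup>2)"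
            unfolding sum_distrib_left using elim
            by (intro sum.cong) (auto simp: point_nth rate_def power_divide)
          also have "\<dots> \<le> n * (\<Sum>i\<in>UNIV. ((?\<theta> - \<theta>s) $ i)\<^sup>2)"
            using elim by (intro mult_left_mono sum_mono2) auto
          also have "(\<Sum>i\<in>UNIV. ((?\<theta> - \<theta>s) $ i)\<^sup>2) = d"
            unfolding d_def power2_norm_eq_inner inner_vec_def by (simp add: power2_eq_square)
          finally show ?thesis using c by simp
        qed
        finally have E: "2 * (n * (H ?\<theta> - H \<theta>s)) + n powr \<gamma> * KL \<theta>s ?\<theta> \<le>
          - c * ((\<Sum>i\<in>Z. y i) + (\<Sum>i\<in>UNIV - {k} - Z. (y i)\<^sup>2))" .
        have P: "(\<Prod>i\<in>- Z. ?\<theta> $ i powr (\<alpha> i - 1)) \<le> (\<Prod>i\<in>- Z. max 1 (\<epsilon> powr (\<alpha> i - 1)))"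
        proof (rule prod_mono, intro conjI)
          fix i assume "i \<in> - Z"
          then have "\<epsilon> \<le> ?\<theta> $ i" using \<epsilon>\<theta> by simp
          show "?\<theta> $ i powr (\<alpha> i - 1) \<le> max 1 (\<epsilon> powr (\<alpha> i - 1))"
          proof (cases "\<alpha> i \<ge> 1")
            case True
            then have "?\<theta> $ i powr (\<alpha> i - 1) \<le> 1 powr (\<alpha> i - 1)"
              using prob_simplex_bounds(1,2)[OF \<theta>] by (intro powr_mono2) auto
            then show ?thesis by simp
          next
            case False
            then have "?\<theta> $ i powr (\<alpha> i - 1) \<le> \<epsilon> powr (\<alpha> i - 1)"
              using \<open>\<epsilon> \<le> ?\<theta> $ i\<close> eps_pos by (intro powr_mono2') auto
            then show ?thesis by simp
          qed
        qed simp
        show ?thesis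
          unfolding rescaled_on_trunc[OF elim(2) y tr] envelope_eq[OF y]
            mult.commute[of "\<Prod>i\<in>Z. y i powr (\<alpha> i - 1)"]
          using P E by (intro mult_mono mult_nonneg_nonneg prod_nonneg) (auto simp: le_max_iff_disj)
      qed
    qed
  qed
  with c show ?thesis by (rule that)
qed

section \<open>Measurability\<close>

text \<open>Continuity of \<open>H\<close> on the simplex makes its product with the indicator of
  the simplex Borel; inserting this product for \<open>H\<close> leaves \<open>weight\<close>
  unchanged.\<close>

lemma measurable_weight [measurable]: "weight n \<in> borel_measurable borel"
proof -
  have simplex [measurable]: "prob_simplex \<in> sets (borel :: (real^'k) measure)"
    by (intro borel_closed compact_imp_closed compact_prob_simplex)
  have "trunc = prob_simplex \<inter> (\<Inter>i\<in>{i. \<theta>s $ i > 0}. {\<theta>. \<epsilon> \<le> \<theta> $ i})"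
    by (auto simp: trunc_def)
  moreover have "closed (\<Inter>i\<in>{i. \<theta>s $ i > 0}. {\<theta>::real^'k. \<epsilon> \<le> \<theta> $ i})"
    by (intro closed_INT ballI closed_Collect_le continuous_intros)
  ultimately have [measurable]: "trunc \<in> sets borel"
    by (simp add: sets.Int borel_closed)
  have [measurable]: "(\<lambda>\<theta>. indicator prob_simplex \<theta> *\<^sub>R H \<theta>) \<in> borel_measurable borel"
    using simplex cont by (rule borel_measurable_continuous_on_indicator)
  have [measurable]: "KL \<theta>s \<in> borel_measurable borel"
    unfolding KL_def by measurable
  have eq: "weight n = (\<lambda>\<theta>. indicator prob_simplex \<theta> * (\<Prod>i\<in>UNIV. \<theta> $ i powr (\<alpha> i - 1)) *
     (exp (2 * n * (indicator prob_simplex \<theta> *\<^sub>R H \<theta>) + n powr \<gamma> * KL \<theta>s \<theta>) * indicator trunc \<theta>))"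
    by (auto simp: fun_eq_iff weight_def indicator_def)
  show ?thesis unfolding eq by measurable
qed

text \<open>The chart ignores coordinate \<open>k\<close>, so its argument may be restricted to the
  index set of the product measure, the form in which \<open>integral_PiM_lborel_affine\<close>
  substitutes.\<close>

lemma point_restrict: "point n y = simplex_chart k (\<lambda>i\<in>UNIV - {k}. \<theta>s $ i + rate n i * y i)"
  unfolding point_def by (rule simplex_chart_cong) simp

lemma measurable_point [measurable]: "point n \<in> borel_measurable (PiM (UNIV - {k}) (\<lambda>_. lborel))"
  unfolding point_restrict[abs_def]
  by (rule measurable_compose[OF _ measurable_simplex_chart]) measurable

lemma measurable_rescaled [measurable]: "rescaled n \<in> borel_measurable (PiM (UNIV - {k}) (\<lambda>_. lborel))"
  unfolding rescaled_def[abs_def] by measurable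

lemma measurable_limit [measurable]: "limit \<in> borel_measurable (PiM (UNIV - {k}) (\<lambda>_. lborel))"
  by (rule borel_measurable_LIMSEQ_real[where u="\<lambda>m. rescaled (real m)"])
    (auto intro: filterlim_compose[OF rescaled_tendsto filterlim_real_sequentially])

lemma limit_nonneg: "0 \<le> limit y"
  by (auto simp: limit_def indicator_def intro!: mult_nonneg_nonneg prod_nonneg)

lemma limit_pos: "\<forall>i\<in>Z. 0 < y i \<Longrightarrow> 0 < limit y"
  unfolding limit_def using theta_s_pos by (intro mult_pos_pos prod_pos) fastforce+

section \<open>Convergence of the integrals and positivity of the limit\<close>

text \<open>Dominated convergence along real \<open>n\<close>; the pointwise limit inherits the
  bound by the envelope and hence its integrability.\<close>

lemma integral_rescaled_tendsto:
  "((\<lambda>n. \<integral>y. rescaled n y \<partial>PiM (UNIV - {k}) (\<lambda>_. lborel)) \<longlongrightarrow>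
    (\<integral>y. limit y \<partial>PiM (UNIV - {k}) (\<lambda>_. lborel))) at_top"
  and integrable_limit: "integrable (PiM (UNIV - {k}) (\<lambda>_. lborel)) limit"
proof -
  obtain c where c: "0 < c" and le: "\<forall>\<^sub>F n in at_top. \<forall>y. rescaled n y \<le> envelope c y"
    by (rule rescaled_le_envelope) (rule that)
  show "((\<lambda>n. \<integral>y. rescaled n y \<partial>PiM (UNIV - {k}) (\<lambda>_. lborel)) \<longlongrightarrow>
    (\<integral>y. limit y \<partial>PiM (UNIV - {k}) (\<lambda>_. lborel))) at_top"
  proof (rule integral_dominated_convergence_at_top[OF _ _ integrable_envelope[OF c]])
    show "\<forall>\<^sub>F n in at_top. AE y in PiM (UNIV - {k}) (\<lambda>_. lborel). norm (rescaled n y) \<le> envelope c y"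
      using le by eventually_elim (simp add: rescaled_nonneg)
  qed (auto simp: rescaled_tendsto)
  have "limit y \<le> envelope c y" for y
  proof (rule tendsto_upperbound[OF rescaled_tendsto])
    show "\<forall>\<^sub>F n in at_top. rescaled n y \<le> envelope c y"
      using le by eventually_elim blast
  qed simp
  then show "integrable (PiM (UNIV - {k}) (\<lambda>_. lborel)) limit"
    by (intro Bochner_Integration.integrable_bound[OF integrable_envelope[OF c]])
      (auto simp: limit_nonneg envelope_nonneg)
qed

text \<open>\<open>limit\<close> is nonnegative and strictly positive on the open unit cube, which
  has measure 1; a zero integral would make the cube a null set.\<close>

lemma integral_limit_pos: "0 < (\<integral>y. limit y \<partial>PiM (UNIV - {k}) (\<lambda>_. lborel))"
proof (rule ccontr)
  let ?M = "PiM (UNIV - {k}) (\<lambda>_. lborel :: real measure)"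
  interpret product_sigma_finite "\<lambda>_::'k. lborel :: real measure"
    by (rule product_sigma_finite_lborel)
  assume "\<not> 0 < (\<integral>y. limit y \<partial>?M)"
  moreover have "0 \<le> (\<integral>y. limit y \<partial>?M)"
    by (simp add: limit_nonneg)
  ultimately have "(\<integral>y. limit y \<partial>?M) = 0" by simp
  then have "AE y in ?M. limit y = 0"
    using integral_nonneg_eq_0_iff_AE[OF integrable_limit] limit_nonneg by simp
  then have "AE y in ?M. y \<notin> Pi\<^sub>E (UNIV - {k}) (\<lambda>_. {0<..<1})"
  proof eventually_elim
    case (elim y)
    show ?case
    proof
      assume y: "y \<in> Pi\<^sub>E (UNIV - {k}) (\<lambda>_. {0<..<1})"
      have "\<forall>i\<in>Z. 0 < y i"
        using k PiE_mem[OF y] by fastforce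
      then show False using limit_pos[of y] elim by simp
    qed
  qed
  moreover have "Pi\<^sub>E (UNIV - {k}) (\<lambda>_. {0<..<1}) \<in> sets ?M"
    by (intro sets_PiM_I_finite) auto
  ultimately have "emeasure ?M (Pi\<^sub>E (UNIV - {k}) (\<lambda>_. {0<..<1})) = 0"
    using AE_iff_null_sets by blast
  moreover have "emeasure ?M (Pi\<^sub>E (UNIV - {k}) (\<lambda>_. {0<..<1})) = 1"
    by (subst emeasure_PiM) auto
  ultimately show False by simp
qed

section \<open>The powers of n\<close>

text \<open>The Jacobian of the blow-up. Since \<open>k\<close> is not in \<open>Z\<close>, the
  chart has \<open>card Z\<close> coordinates of rate \<open>1 / n\<close> and
  \<open>CARD('k) - 1 - card Z\<close> of rate \<open>1 / sqrt n\<close>.\<close>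

lemma prod_rate:
  assumes n: "0 < n"
  shows "(\<Prod>i\<in>UNIV - {k}. rate n i) =
    n powr (- (real CARD('k) - 1 - real (card Z)) / 2) * n powr (- real (card Z))"
proof -
  have I: "UNIV - {k} = Z \<union> (UNIV - {k} - Z)" "Z \<inter> (UNIV - {k} - Z) = {}"
    using k by auto
  have "card (UNIV - {k}) = card Z + card (UNIV - {k} - Z)"
    using card_Un_disjoint[OF _ _ I(2)] I(1) by simp
  moreover have "card (UNIV - {k}) = CARD('k) - 1" "CARD('k) \<ge> 1"
    by (simp_all add: card_Diff_singleton Suc_leI)
  ultimately have card: "real (card (UNIV - {k} - Z)) = real CARD('k) - 1 - real (card Z)"
    by linarith
  have "(\<Prod>i\<in>UNIV - {k}. rate n i) = (\<Prod>i\<in>Z. n powr -1) * (\<Prod>i\<in>UNIV - {k} - Z. n powr (-1/2))"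
    by (subst I(1), subst prod.union_disjoint[OF _ _ I(2)])
      (use n in \<open>auto simp: rate_def powr_minus powr_half_sqrt field_simps\<close>)
  also have "\<dots> = n powr (\<Sum>i\<in>Z. -1) * n powr (\<Sum>i\<in>UNIV - {k} - Z. -1/2)"
    using n by (intro arg_cong2[where f="(*)"] powr_sum[symmetric]) auto
  also have "\<dots> = n powr (- real (card Z)) * n powr (- real (card (UNIV - {k} - Z)) / 2)"
    by simp
  finally show ?thesis
    by (simp add: card mult.commute)
qed

text \<open>Change to the chart eliminating \<open>k\<close>, then rescale. The Jacobian factor
  \<open>n powr (- real (card Z))\<close> cancels against the prefactors of \<open>rescaled\<close>,
  leaving only the sum of the \<open>\<alpha> i\<close> over \<open>Z\<close> in the
  exponent.\<close>

lemma integral_weight_simplex_chart: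
  assumes n: "0 < n"
  shows "(\<integral>x. weight n (simplex_chart l x) \<partial>PiM (UNIV - {l}) (\<lambda>_. lborel)) =
    exp (2 * n * H \<theta>s) * n powr (- (real CARD('k) - 1 - real (card Z)) / 2) * n powr (- (\<Sum>i\<in>Z. \<alpha> i)) *
    (\<integral>y. rescaled n y \<partial>PiM (UNIV - {k}) (\<lambda>_. lborel))"
proof -
  let ?M = "PiM (UNIV - {k}) (\<lambda>_. lborel :: real measure)"
  define W where "W = (\<integral>y. weight n (point n y) \<partial>?M)"
  have "(\<integral>x. weight n (simplex_chart l x) \<partial>PiM (UNIV - {l}) (\<lambda>_. lborel)) =
    (\<integral>x. weight n (simplex_chart k x) \<partial>?M)"
    by (rule integral_simplex_chart_eq) simp
  also have "\<dots> = (\<Prod>i\<in>UNIV - {k}. rate n i) * W"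
    unfolding W_def point_restrict using n
    by (intro integral_PiM_lborel_affine) (auto simp: rate_def)
  finally have 1: "(\<integral>x. weight n (simplex_chart l x) \<partial>PiM (UNIV - {l}) (\<lambda>_. lborel)) =
    n powr (- (real CARD('k) - 1 - real (card Z)) / 2) * n powr (- real (card Z)) * W"
    by (simp only: prod_rate[OF n])
  have "(\<Prod>i\<in>Z. n powr (\<alpha> i - 1)) = n powr ((\<Sum>i\<in>Z. \<alpha> i) - real (card Z))"
    using n by (simp add: powr_sum[symmetric] sum_subtractf)
  then have 2: "(\<integral>y. rescaled n y \<partial>?M) = n powr ((\<Sum>i\<in>Z. \<alpha> i) - real (card Z)) * exp (- 2 * n * H \<theta>s) * W"
    by (simp add: rescaled_def W_def)
  have "exp (2 * n * H \<theta>s) * n powr (- (\<Sum>i\<in>Z. \<alpha> i)) *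
    (n powr ((\<Sum>i\<in>Z. \<alpha> i) - real (card Z)) * exp (- 2 * n * H \<theta>s)) =
    (exp (2 * n * H \<theta>s) * exp (- 2 * n * H \<theta>s)) *
    (n powr (- (\<Sum>i\<in>Z. \<alpha> i)) * n powr ((\<Sum>i\<in>Z. \<alpha> i) - real (card Z)))"
    by (simp only: mult_ac)
  also have "\<dots> = n powr (- real (card Z))"
    using n by (simp add: exp_add[symmetric] powr_add[symmetric])
  finally have 3: "exp (2 * n * H \<theta>s) * n powr (- (\<Sum>i\<in>Z. \<alpha> i)) *
    (n powr ((\<Sum>i\<in>Z. \<alpha> i) - real (card Z)) * exp (- 2 * n * H \<theta>s)) = n powr (- real (card Z))" .
  show ?thesis
    unfolding 1 2 3[symmetric] by (simp only: mult_ac)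
qed

end

section \<open>The asymptotic equivalence\<close>

theorem theorem2:
  fixes H :: "(real, 'k::{finite,linorder}) vec \<Rightarrow> real"
    and \<alpha> :: "'k \<Rightarrow> real"
    and \<theta>s :: "(real, 'k) vec"
    and \<epsilon> \<gamma> :: real
    and U :: "((real, 'k) vec) set"
    and grad :: "(real, 'k) vec \<Rightarrow> (real, 'k) vec"
    and Hess :: "(real, 'k) vec \<Rightarrow> ((real, 'k) vec, 'k) vec"
    and lam :: "'k \<Rightarrow> real" and \<mu> :: real
  defines "Z \<equiv> {i. \<theta>s $ i = 0}"
  defines "m \<equiv> card Z"
  assumes K2: "CARD('k) \<ge> 2"
    and alpha_pos: "\<forall>i. \<alpha> i > 0"
    and theta_s: "\<theta>s \<in> prob_simplex"
    (* A1 *)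
    and A1: "\<forall>\<theta>\<in>prob_simplex. \<theta> \<noteq> \<theta>s \<longrightarrow> H \<theta> < H \<theta>s"
    (* A2: continuity on the prob_simplex, C^2 on an open neighbourhood of theta* *)
    and cont: "continuous_on prob_simplex H"
    and U_open: "open U" and U_mem: "\<theta>s \<in> U"
    and grad_deriv: "\<forall>x\<in>U. (H has_derivative (\<lambda>h. grad x \<bullet> h)) (at x)"
    and hess_deriv: "\<forall>x\<in>U. (grad has_derivative (\<lambda>h. Hess x *v h)) (at x)"
    and hess_cont: "continuous_on U Hess"
    (* A2: KKT multipliers; A3: they are strictly positive *)
    and KKT: "grad \<theta>s = (\<chi> i. (if i \<in> Z then - lam i else 0) + \<mu>)"
    and A3: "\<forall>i\<in>Z. lam i > 0"
    (* A4 *)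
    and A4: "\<forall>d::(real, 'k) vec. d \<noteq> 0 \<and> (\<Sum>i\<in>UNIV. d $ i) = 0 \<and> (\<forall>i\<in>Z. d $ i = 0)
               \<longrightarrow> d \<bullet> (Hess \<theta>s *v d) < 0"
    and eps_pos: "0 < \<epsilon>"
    and eps_lt: "\<forall>i. \<theta>s $ i > 0 \<longrightarrow> \<epsilon> < \<theta>s $ i"
    and gamma: "0 < \<gamma>" "\<gamma> < 1"
  shows "\<exists>C>0. (\<lambda>n::real. dirichlet_expectation \<alpha>
             (\<lambda>\<theta>. exp (2 * n * H \<theta> + n powr \<gamma> * KL \<theta>s \<theta>) *
                   indicator {\<theta>\<in>prob_simplex. \<forall>i. \<theta>s $ i > 0 \<longrightarrow> \<theta> $ i \<ge> \<epsilon>} \<theta>))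
           \<sim>[at_top] (\<lambda>n. C * exp (2 * n * H \<theta>s) * n powr (- (real CARD('k) - 1 - real m) / 2)
                         * n powr (- (\<Sum>i\<in>Z. \<alpha> i)))"
proof -
  \<comment> \<open>A point of total mass one has a nonzero coordinate.\<close>
  obtain k where k: "k \<notin> Z"
  proof (rule ccontr)
    assume "\<not> thesis"
    then have "\<theta>s $ i = 0" for i
      using that by (auto simp: Z_def)
    then show False
      using theta_s by (simp add: prob_simplex_def)
  qed
  interpret simplex_laplace H \<theta>s U grad "Hess \<theta>s" lam \<mu> Z \<alpha> \<epsilon> \<gamma> k
    using assms k by unfold_locales (auto simp: Z_def)
  define L where "L = (\<integral>y. limit y \<partial>PiM (UNIV - {k}) (\<lambda>_. lborel))"
  define R where "R n = (\<integral>y. rescaled n y \<partial>PiM (UNIV - {k}) (\<lambda>_. lborel))" for n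
  have L: "0 < L"
    unfolding L_def by (rule integral_limit_pos)
  have B: "0 < multi_beta \<alpha>"
    unfolding multi_beta_def using alpha_pos
    by (intro divide_pos_pos prod_pos Gamma_real_pos sum_pos) auto
  define S where "S n = exp (2 * n * H \<theta>s) * n powr (- (real CARD('k) - 1 - real m) / 2) * n powr (- (\<Sum>i\<in>Z. \<alpha> i))" for n
  \<comment> \<open>The expectation is written in the chart eliminating \<open>last_idx\<close>,
    which may lie in \<open>Z\<close>; the integral formula holds for every chart
    \<open>l\<close>.\<close>
  have D: "dirichlet_expectation \<alpha> (\<lambda>\<theta>. exp (2 * n * H \<theta> + n powr \<gamma> * KL \<theta>s \<theta>) *
      indicator {\<theta>\<in>prob_simplex. \<forall>i. \<theta>s $ i > 0 \<longrightarrow> \<theta> $ i \<ge> \<epsilon>} \<theta>) = 1 / multi_beta \<alpha> * (S n * R n)"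
    if "0 < n" for n
    using integral_weight_simplex_chart[OF that, of last_idx]
    by (simp add: dirichlet_expectation_def simplex_chart_last_idx weight_def trunc_def S_def R_def m_def)
  show ?thesis
  proof (intro exI conjI)
    \<comment> \<open>The constant is the integral of \<open>limit\<close> divided by the Dirichlet
      normalisation; with it, the ratio of the two sides is exactly \<open>R n / L\<close> for
      positive \<open>n\<close>.\<close>
    show "0 < L / multi_beta \<alpha>" using L B by simp
    have "((\<lambda>n. R n / L) \<longlongrightarrow> L / L) at_top"
      using L unfolding R_def L_def by (intro tendsto_divide integral_rescaled_tendsto tendsto_const) auto
    then have lim: "((\<lambda>n. R n / L) \<longlongrightarrow> 1) at_top"
      using L by simp
    show "(\<lambda>n::real. dirichlet_expectation \<alpha>
             (\<lambda>\<theta>. exp (2 * n * H \<theta> + n powr \<gamma> * KL \<theta>s \<theta>) *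
                   indicator {\<theta>\<in>prob_simplex. \<forall>i. \<theta>s $ i > 0 \<longrightarrow> \<theta> $ i \<ge> \<epsilon>} \<theta>))
           \<sim>[at_top] (\<lambda>n. L / multi_beta \<alpha> * exp (2 * n * H \<theta>s) * n powr (- (real CARD('k) - 1 - real m) / 2)
                         * n powr (- (\<Sum>i\<in>Z. \<alpha> i)))"
    proof (rule asymp_equivI', rule Lim_transform_eventually[OF lim])
      show "\<forall>\<^sub>F n in at_top. R n / L = dirichlet_expectation \<alpha>
             (\<lambda>\<theta>. exp (2 * n * H \<theta> + n powr \<gamma> * KL \<theta>s \<theta>) *
                   indicator {\<theta>\<in>prob_simplex. \<forall>i. \<theta>s $ i > 0 \<longrightarrow> \<theta> $ i \<ge> \<epsilon>} \<theta>) /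
            (L / multi_beta \<alpha> * exp (2 * n * H \<theta>s) * n powr (- (real CARD('k) - 1 - real m) / 2)
                         * n powr (- (\<Sum>i\<in>Z. \<alpha> i)))"
        using eventually_gt_at_top[of 0]
      proof eventually_elim
        case (elim n)
        have "S n > 0" using elim by (simp add: S_def)
        moreover have "L / multi_beta \<alpha> * exp (2 * n * H \<theta>s) * n powr (- (real CARD('k) - 1 - real m) / 2)
                         * n powr (- (\<Sum>i\<in>Z. \<alpha> i)) = L / multi_beta \<alpha> * S n"
          by (simp only: S_def mult.assoc)
        ultimately show ?case
          unfolding D[OF elim] using L B by (simp add: field_simps)
      qed
    qed
  qed
qed

end
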